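(* Let $C$ be a Reedy category. The fully faithful functor $\mathrm{Down}(C)\hookrightarrow\mathrm{Down}_*(C)$ induced by the inclusion $\int N^{--,+}_+(C)\subseteq\int N^{-,+}(C)$ is an equivalence of categories.
   Context: A Reedy category $(C,C_-,C_+)$: wide subcategories with unique factorization of every morphism as ($C_-$ then $C_+$), membership in $C_\pm$ decidable, and the relation ($x<'y$ iff non-identity $x\to y$ in $C_+$ or non-identity $y\to x$ in $C_-$) well-founded. $\Delta$: finite ordinals $[n]$ and order-preserving maps. $\int N^{-,+}(C)$: objects $([n],X)$ with $X\colon[n]\to C$ a functor sending all morphisms into $C_-$; morphisms $([m],X)\to([n],Y)$ are $(\alpha,\theta)$ with $\alpha\colon[m]\to[n]$ in $\Delta$ and $\theta\colon X\Rightarrow Y\circ\alpha$ with all components in $C_+$; composition $(\beta,\varphi)\circ(\alpha,\theta)=(\beta\alpha,(\varphi\alpha)\circ\theta)$. $\int N^{--,+}_+(C)$: the full subcategory on objects whose $X$ reflects identities. Order on hom-sets: $(\alpha,\theta)\le(\alpha',\theta')$ iff $\alpha\le\alpha'$ pointwise and $\theta'_i=Y(\alpha(i)\le\alpha'(i))\circ\theta_i$ for all $i$ (compatible with composition). $\mathrm{Down}_*(C)$ and $\mathrm{Down}(C)$ are obtained from $\int N^{-,+}(C)$ and $\int N^{--,+}_+(C)$ by quotienting each hom-set by the equivalence relation generated by $\le$. *)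

theory Defs
  imports Main
begin

record ('o, 'm) cat =
  c_obj :: "'o set"
  c_arr :: "'m set"
  c_dom :: "'m \<Rightarrow> 'o"
  c_cod :: "'m \<Rightarrow> 'o"
  c_comp :: "'m \<Rightarrow> 'm \<Rightarrow> 'm"   (* c_comp g f = g o f *)
  c_id :: "'o \<Rightarrow> 'm"

definition category :: "('o, 'm) cat \<Rightarrow> bool" where
  "category C \<longleftrightarrow>
     (\<forall>f\<in>c_arr C. c_dom C f \<in> c_obj C \<and> c_cod C f \<in> c_obj C) \<and>
     (\<forall>x\<in>c_obj C. c_id C x \<in> c_arr C \<and> c_dom C (c_id C x) = x \<and> c_cod C (c_id C x) = x) \<and>
     (\<forall>f\<in>c_arr C. \<forall>g\<in>c_arr C. c_cod C f = c_dom C g \<longrightarrow>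
        c_comp C g f \<in> c_arr C \<and> c_dom C (c_comp C g f) = c_dom C f \<and>
        c_cod C (c_comp C g f) = c_cod C g) \<and>
     (\<forall>f\<in>c_arr C. c_comp C (c_id C (c_cod C f)) f = f \<and> c_comp C f (c_id C (c_dom C f)) = f) \<and>
     (\<forall>f\<in>c_arr C. \<forall>g\<in>c_arr C. \<forall>h\<in>c_arr C. c_cod C f = c_dom C g \<longrightarrow> c_cod C g = c_dom C h \<longrightarrow>
        c_comp C h (c_comp C g f) = c_comp C (c_comp C h g) f)"

definition "functor" :: "('o, 'm) cat \<Rightarrow> ('p, 'n) cat \<Rightarrow> ('o \<Rightarrow> 'p) \<Rightarrow> ('m \<Rightarrow> 'n) \<Rightarrow> bool" where
  "functor C D Fo Fm \<longleftrightarrow> category C \<and> category D \<and>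
     (\<forall>x\<in>c_obj C. Fo x \<in> c_obj D) \<and>
     (\<forall>f\<in>c_arr C. Fm f \<in> c_arr D \<and> c_dom D (Fm f) = Fo (c_dom C f) \<and> c_cod D (Fm f) = Fo (c_cod C f)) \<and>
     (\<forall>x\<in>c_obj C. Fm (c_id C x) = c_id D (Fo x)) \<and>
     (\<forall>f\<in>c_arr C. \<forall>g\<in>c_arr C. c_cod C f = c_dom C g \<longrightarrow> Fm (c_comp C g f) = c_comp D (Fm g) (Fm f))"

definition iso_arr :: "('o, 'm) cat \<Rightarrow> 'm \<Rightarrow> bool" where
  "iso_arr C f \<longleftrightarrow> f \<in> c_arr C \<and> (\<exists>g\<in>c_arr C. c_dom C g = c_cod C f \<and> c_cod C g = c_dom C f \<and>
     c_comp C g f = c_id C (c_dom C f) \<and> c_comp C f g = c_id C (c_cod C f))"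

definition nat_iso :: "('o, 'm) cat \<Rightarrow> ('p, 'n) cat \<Rightarrow> ('o \<Rightarrow> 'p) \<Rightarrow> ('m \<Rightarrow> 'n)
     \<Rightarrow> ('o \<Rightarrow> 'p) \<Rightarrow> ('m \<Rightarrow> 'n) \<Rightarrow> ('o \<Rightarrow> 'n) \<Rightarrow> bool" where
  "nat_iso C D Fo Fm Go Gm eta \<longleftrightarrow> functor C D Fo Fm \<and> functor C D Go Gm \<and>
     (\<forall>x\<in>c_obj C. iso_arr D (eta x) \<and> c_dom D (eta x) = Fo x \<and> c_cod D (eta x) = Go x) \<and>
     (\<forall>f\<in>c_arr C. c_comp D (Gm f) (eta (c_dom C f)) = c_comp D (eta (c_cod C f)) (Fm f))"

definition equivalence :: "('o, 'm) cat \<Rightarrow> ('p, 'n) cat \<Rightarrow> ('o \<Rightarrow> 'p) \<Rightarrow> ('m \<Rightarrow> 'n) \<Rightarrow> bool" where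
  "equivalence C D Fo Fm \<longleftrightarrow> functor C D Fo Fm \<and>
     (\<exists>Go Gm eta eps. functor D C Go Gm \<and>
        nat_iso C C (\<lambda>x. x) (\<lambda>f. f) (Go \<circ> Fo) (Gm \<circ> Fm) eta \<and>
        nat_iso D D (Fo \<circ> Go) (Fm \<circ> Gm) (\<lambda>x. x) (\<lambda>f. f) eps)"

definition wide_subcat :: "('o, 'm) cat \<Rightarrow> 'm set \<Rightarrow> bool" where
  "wide_subcat C S \<longleftrightarrow> S \<subseteq> c_arr C \<and> (\<forall>x\<in>c_obj C. c_id C x \<in> S) \<and>
     (\<forall>f\<in>S. \<forall>g\<in>S. c_cod C f = c_dom C g \<longrightarrow> c_comp C g f \<in> S)"

definition reedy_rel :: "('o, 'm) cat \<Rightarrow> 'm set \<Rightarrow> 'm set \<Rightarrow> 'o \<Rightarrow> 'o \<Rightarrow> bool" where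
  "reedy_rel C Cm Cp x y \<longleftrightarrow> x \<in> c_obj C \<and> y \<in> c_obj C \<and>
     ((\<exists>f\<in>Cp. c_dom C f = x \<and> c_cod C f = y \<and> f \<noteq> c_id C x) \<or>
      (\<exists>f\<in>Cm. c_dom C f = y \<and> c_cod C f = x \<and> f \<noteq> c_id C y))"

text \<open>Membership in Cm, Cp is decidable classically; no extra condition is needed in HOL.\<close>
definition reedy :: "('o, 'm) cat \<Rightarrow> 'm set \<Rightarrow> 'm set \<Rightarrow> bool" where
  "reedy C Cm Cp \<longleftrightarrow> category C \<and> wide_subcat C Cm \<and> wide_subcat C Cp \<and>
     (\<forall>f\<in>c_arr C. \<exists>!pq. fst pq \<in> Cm \<and> snd pq \<in> Cp \<and> c_cod C (fst pq) = c_dom C (snd pq) \<and>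
         c_comp C (snd pq) (fst pq) = f) \<and>
     wfP (reedy_rel C Cm Cp)"

text \<open>Object ([n], X): X given by its object part Xo i (i \<le> n) and its action Xm i j on
  the unique arrow i \<le> j of [n]; extensional (undefined) outside the range.\<close>
type_synonym ('o, 'm) nobj = "nat \<times> (nat \<Rightarrow> 'o) \<times> (nat \<Rightarrow> nat \<Rightarrow> 'm)"

text \<open>Morphism (source, target, alpha, theta), extensional outside [m].\<close>
type_synonym ('o, 'm) nmor = "('o, 'm) nobj \<times> ('o, 'm) nobj \<times> (nat \<Rightarrow> nat) \<times> (nat \<Rightarrow> 'm)"

definition nerve_obj :: "('o, 'm) cat \<Rightarrow> 'm set \<Rightarrow> ('o, 'm) nobj \<Rightarrow> bool" where
  "nerve_obj C Cm A \<longleftrightarrow> (case A of (n, Xo, Xm) \<Rightarrow>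
     (\<forall>i\<le>n. Xo i \<in> c_obj C) \<and> (\<forall>i>n. Xo i = undefined) \<and>
     (\<forall>i j. i \<le> j \<and> j \<le> n \<longrightarrow> Xm i j \<in> Cm \<and> c_dom C (Xm i j) = Xo i \<and> c_cod C (Xm i j) = Xo j) \<and>
     (\<forall>i j. \<not> (i \<le> j \<and> j \<le> n) \<longrightarrow> Xm i j = undefined) \<and>
     (\<forall>i\<le>n. Xm i i = c_id C (Xo i)) \<and>
     (\<forall>i j k. i \<le> j \<and> j \<le> k \<and> k \<le> n \<longrightarrow> c_comp C (Xm j k) (Xm i j) = Xm i k))"

definition reflects_ids :: "('o, 'm) cat \<Rightarrow> ('o, 'm) nobj \<Rightarrow> bool" where
  "reflects_ids C A \<longleftrightarrow> (case A of (n, Xo, Xm) \<Rightarrow>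
     (\<forall>i j. i \<le> j \<and> j \<le> n \<and> (\<exists>y\<in>c_obj C. Xm i j = c_id C y) \<longrightarrow> i = j))"

definition nerve_mor :: "('o, 'm) cat \<Rightarrow> 'm set \<Rightarrow> 'm set \<Rightarrow> ('o, 'm) nmor \<Rightarrow> bool" where
  "nerve_mor C Cm Cp f \<longleftrightarrow> (case f of ((m, Xo, Xm), (n, Yo, Ym), \<alpha>, \<theta>) \<Rightarrow>
     nerve_obj C Cm (m, Xo, Xm) \<and> nerve_obj C Cm (n, Yo, Ym) \<and>
     (\<forall>i\<le>m. \<alpha> i \<le> n) \<and> (\<forall>i j. i \<le> j \<and> j \<le> m \<longrightarrow> \<alpha> i \<le> \<alpha> j) \<and>
     (\<forall>i>m. \<alpha> i = undefined) \<and> (\<forall>i>m. \<theta> i = undefined) \<and>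
     (\<forall>i\<le>m. \<theta> i \<in> Cp \<and> c_dom C (\<theta> i) = Xo i \<and> c_cod C (\<theta> i) = Yo (\<alpha> i)) \<and>
     (\<forall>i j. i \<le> j \<and> j \<le> m \<longrightarrow> c_comp C (Ym (\<alpha> i) (\<alpha> j)) (\<theta> i) = c_comp C (\<theta> j) (Xm i j)))"

definition nerve_comp :: "('o, 'm) cat \<Rightarrow> ('o, 'm) nmor \<Rightarrow> ('o, 'm) nmor \<Rightarrow> ('o, 'm) nmor" where
  "nerve_comp C g f = (case f of (A, B, \<alpha>, \<theta>) \<Rightarrow> (case g of (B', D, \<beta>, \<phi>) \<Rightarrow>
     (A, D, (\<lambda>i. if i \<le> fst A then \<beta> (\<alpha> i) else undefined),
            (\<lambda>i. if i \<le> fst A then c_comp C (\<phi> (\<alpha> i)) (\<theta> i) else undefined))))"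

definition nerve_id :: "('o, 'm) cat \<Rightarrow> ('o, 'm) nobj \<Rightarrow> ('o, 'm) nmor" where
  "nerve_id C A = (case A of (n, Xo, Xm) \<Rightarrow>
     (A, A, (\<lambda>i. if i \<le> n then i else undefined), (\<lambda>i. if i \<le> n then c_id C (Xo i) else undefined)))"

definition int_N :: "('o, 'm) cat \<Rightarrow> 'm set \<Rightarrow> 'm set \<Rightarrow> (('o, 'm) nobj, ('o, 'm) nmor) cat" where
  "int_N C Cm Cp = \<lparr> c_obj = {A. nerve_obj C Cm A},
                     c_arr = {f. nerve_mor C Cm Cp f},
                     c_dom = (\<lambda>f. fst f), c_cod = (\<lambda>f. fst (snd f)),
                     c_comp = nerve_comp C, c_id = nerve_id C \<rparr>"

definition int_N_plus :: "('o, 'm) cat \<Rightarrow> 'm set \<Rightarrow> 'm set \<Rightarrow> (('o, 'm) nobj, ('o, 'm) nmor) cat" where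
  "int_N_plus C Cm Cp = \<lparr> c_obj = {A. nerve_obj C Cm A \<and> reflects_ids C A},
                     c_arr = {f. nerve_mor C Cm Cp f \<and> reflects_ids C (fst f) \<and> reflects_ids C (fst (snd f))},
                     c_dom = (\<lambda>f. fst f), c_cod = (\<lambda>f. fst (snd f)),
                     c_comp = nerve_comp C, c_id = nerve_id C \<rparr>"

definition nerve_le :: "('o, 'm) cat \<Rightarrow> ('o, 'm) nmor \<Rightarrow> ('o, 'm) nmor \<Rightarrow> bool" where
  "nerve_le C f g \<longleftrightarrow> (case f of (A, B, \<alpha>, \<theta>) \<Rightarrow> (case g of (A', B', \<alpha>', \<theta>') \<Rightarrow>
     A = A' \<and> B = B' \<and>
     (\<forall>i\<le>fst A. \<alpha> i \<le> \<alpha>' i \<and> \<theta>' i = c_comp C (snd (snd B) (\<alpha> i) (\<alpha>' i)) (\<theta> i))))"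

text \<open>Equivalence relation on the arrows of I generated by le (le relates only
  parallel arrows, so this is the hom-set-wise generated equivalence).\<close>
definition gen_equiv :: "('o, 'm) cat \<Rightarrow> ('m \<Rightarrow> 'm \<Rightarrow> bool) \<Rightarrow> 'm rel" where
  "gen_equiv I le = {(f, g). f \<in> c_arr I \<and> g \<in> c_arr I \<and> (le f g \<or> le g f)}\<^sup>*"

definition qcls :: "('o, 'm) cat \<Rightarrow> ('m \<Rightarrow> 'm \<Rightarrow> bool) \<Rightarrow> 'm \<Rightarrow> 'm set" where
  "qcls I le f = gen_equiv I le `` {f}"

definition quot_cat :: "('o, 'm) cat \<Rightarrow> ('m \<Rightarrow> 'm \<Rightarrow> bool) \<Rightarrow> ('o, 'm set) cat" where
  "quot_cat I le = \<lparr> c_obj = c_obj I,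
     c_arr = qcls I le ` c_arr I,
     c_dom = (\<lambda>E. c_dom I (SOME f. f \<in> E)),
     c_cod = (\<lambda>E. c_cod I (SOME f. f \<in> E)),
     c_comp = (\<lambda>E F. qcls I le (c_comp I (SOME f. f \<in> E) (SOME f. f \<in> F))),
     c_id = (\<lambda>x. qcls I le (c_id I x)) \<rparr>"

definition Down_star :: "('o, 'm) cat \<Rightarrow> 'm set \<Rightarrow> 'm set \<Rightarrow> (('o, 'm) nobj, ('o, 'm) nmor set) cat" where
  "Down_star C Cm Cp = quot_cat (int_N C Cm Cp) (nerve_le C)"

definition Down :: "('o, 'm) cat \<Rightarrow> 'm set \<Rightarrow> 'm set \<Rightarrow> (('o, 'm) nobj, ('o, 'm) nmor set) cat" where
  "Down C Cm Cp = quot_cat (int_N_plus C Cm Cp) (nerve_le C)"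

definition Down_incl_mor :: "('o, 'm) cat \<Rightarrow> 'm set \<Rightarrow> 'm set \<Rightarrow> ('o, 'm) nmor set \<Rightarrow> ('o, 'm) nmor set" where
  "Down_incl_mor C Cm Cp E = qcls (int_N C Cm Cp) (nerve_le C) (SOME f. f \<in> E)"

end

theory Submission
  imports Defs
begin

text \<open>Since the relation generating the quotient only relates parallel arrows, quotienting commutes
  with passing to the full subcategory \<open>\<integral> N^{--,+}_+(C)\<close>; so \<open>Down(C)\<close> is a full subcategory of
  \<open>Down_*(C)\<close> and it remains to show that every object \<open>([n], X)\<close> of \<open>Down_*(C)\<close> is isomorphic to
  one on which \<open>X\<close> reflects identities.

  If \<open>X\<close> does not reflect identities, some \<open>X(i \<le> j)\<close> with \<open>i < j\<close> is an identity. A \<open>C_-\<close>-chain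
  that returns to its starting object is constant, by well-foundedness of the Reedy order, so the
  edge \<open>X(i \<le> i + 1)\<close> is an identity as well. Deleting the vertex \<open>i + 1\<close> gives the face \<open>X \<delta>\<close>, and
  the coface \<open>(\<delta>, id)\<close> and codegeneracy \<open>(\<sigma>, id)\<close> satisfy \<open>\<sigma> \<delta> = id\<close> and \<open>\<delta> \<sigma> \<le> id\<close>, hence
  become inverse isomorphisms in \<open>Down_*(C)\<close>.\<close>

section \<open>Categories, full subcategories and equivalences\<close>

lemma cat_dom_cod:
  assumes "category C" "f \<in> c_arr C"
  shows "c_dom C f \<in> c_obj C" "c_cod C f \<in> c_obj C"
  using assms unfolding category_def by blast+

lemma cat_id:
  assumes "category C" "x \<in> c_obj C"
  shows "c_id C x \<in> c_arr C" "c_dom C (c_id C x) = x" "c_cod C (c_id C x) = x"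
  using assms unfolding category_def by blast+

lemma cat_comp:
  assumes "category C" "f \<in> c_arr C" "g \<in> c_arr C" "c_cod C f = c_dom C g"
  shows "c_comp C g f \<in> c_arr C" "c_dom C (c_comp C g f) = c_dom C f"
    "c_cod C (c_comp C g f) = c_cod C g"
  using assms unfolding category_def by blast+

lemma cat_idl:
  assumes "category C" "f \<in> c_arr C" "c_cod C f = y"
  shows "c_comp C (c_id C y) f = f"
  using assms unfolding category_def by blast

lemma cat_idr:
  assumes "category C" "f \<in> c_arr C" "c_dom C f = x"
  shows "c_comp C f (c_id C x) = f"
  using assms unfolding category_def by blast

lemma cat_assoc:
  assumes "category C" "f \<in> c_arr C" "g \<in> c_arr C" "h \<in> c_arr C"
    "c_cod C f = c_dom C g" "c_cod C g = c_dom C h"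
  shows "c_comp C h (c_comp C g f) = c_comp C (c_comp C h g) f"
  using assms unfolding category_def by blast

lemma functor_id: "category C \<Longrightarrow> functor C C (\<lambda>x. x) (\<lambda>f. f)"
  unfolding functor_def by (auto dest: cat_dom_cod)

lemma functor_comp:
  assumes "functor A B F Fm" "functor B D G Gm"
  shows "functor A D (G \<circ> F) (Gm \<circ> Fm)"
  using assms unfolding functor_def by auto

lemma iso_arrE:
  assumes "iso_arr C f"
  obtains g where "f \<in> c_arr C" "g \<in> c_arr C" "c_dom C g = c_cod C f" "c_cod C g = c_dom C f"
    "c_comp C g f = c_id C (c_dom C f)" "c_comp C f g = c_id C (c_cod C f)"
  using assms unfolding iso_arr_def by blast

lemma iso_arr_id:
  assumes "category D" "x \<in> c_obj D"
  shows "iso_arr D (c_id D x)"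
  unfolding iso_arr_def using cat_id[OF assms] cat_idl[OF assms(1), of "c_id D x" x] by auto

lemma iso_arr_comp:
  assumes D: "category D" and f: "iso_arr D f" and g: "iso_arr D g" and fg: "c_cod D f = c_dom D g"
  shows "iso_arr D (c_comp D g f)"
proof -
  obtain f' where f': "f \<in> c_arr D" "f' \<in> c_arr D" "c_dom D f' = c_cod D f" "c_cod D f' = c_dom D f"
    "c_comp D f' f = c_id D (c_dom D f)" "c_comp D f f' = c_id D (c_cod D f)"
    using iso_arrE[OF f] by metis
  obtain g' where g': "g \<in> c_arr D" "g' \<in> c_arr D" "c_dom D g' = c_cod D g" "c_cod D g' = c_dom D g"
    "c_comp D g' g = c_id D (c_dom D g)" "c_comp D g g' = c_id D (c_cod D g)"
    using iso_arrE[OF g] by metis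
  have gf: "c_comp D g f \<in> c_arr D" "c_dom D (c_comp D g f) = c_dom D f"
    "c_cod D (c_comp D g f) = c_cod D g"
    using cat_comp[OF D f'(1) g'(1) fg] by auto
  have f'g': "c_comp D f' g' \<in> c_arr D" "c_dom D (c_comp D f' g') = c_cod D g"
    "c_cod D (c_comp D f' g') = c_dom D f"
    using cat_comp[OF D g'(2) f'(2)] f' g' fg by auto
  have "c_comp D (c_comp D f' g') (c_comp D g f) = c_comp D f' (c_comp D g' (c_comp D g f))"
    using cat_assoc[OF D gf(1) g'(2) f'(2)] f' g' gf fg by auto
  also have "c_comp D g' (c_comp D g f) = c_comp D (c_comp D g' g) f"
    using cat_assoc[OF D f'(1) g'(1) g'(2)] f' g' fg by auto
  also have "\<dots> = f" using g'(5) fg[symmetric] cat_idl[OF D f'(1)] by simp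
  finally have left_inv: "c_comp D (c_comp D f' g') (c_comp D g f) = c_id D (c_dom D (c_comp D g f))"
    using f' gf by simp
  have "c_comp D (c_comp D g f) (c_comp D f' g') = c_comp D g (c_comp D f (c_comp D f' g'))"
    using cat_assoc[OF D f'g'(1) f'(1) g'(1)] f' g' f'g' fg by auto
  also have "c_comp D f (c_comp D f' g') = c_comp D (c_comp D f f') g'"
    using cat_assoc[OF D g'(2) f'(2) f'(1)] f' g' fg by auto
  also have "\<dots> = g'" using f'(6) fg cat_idl[OF D g'(2)] g' by simp
  finally have right_inv: "c_comp D (c_comp D g f) (c_comp D f' g') = c_id D (c_cod D (c_comp D g f))"
    using g' gf by simp
  show ?thesis
    unfolding iso_arr_def using gf f'g' left_inv right_inv by (intro conjI bexI[of _ "c_comp D f' g'"]) auto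
qed

definition isomorphic :: "('o, 'm) cat \<Rightarrow> 'o \<Rightarrow> 'o \<Rightarrow> bool" where
  "isomorphic D x y \<longleftrightarrow> (\<exists>e. iso_arr D e \<and> c_dom D e = x \<and> c_cod D e = y)"

lemma isomorphic_refl: "category D \<Longrightarrow> x \<in> c_obj D \<Longrightarrow> isomorphic D x x"
  unfolding isomorphic_def using iso_arr_id[of D x] cat_id[of D x] by blast

lemma isomorphic_trans:
  assumes D: "category D" and "isomorphic D x y" "isomorphic D y z"
  shows "isomorphic D x z"
proof -
  obtain e1 e2 where e1: "iso_arr D e1" "c_dom D e1 = x" "c_cod D e1 = y"
    and e2: "iso_arr D e2" "c_dom D e2 = y" "c_cod D e2 = z"
    using assms(2,3) unfolding isomorphic_def by blast
  have "e1 \<in> c_arr D" "e2 \<in> c_arr D" using e1(1) e2(1) by (auto elim: iso_arrE)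
  then show ?thesis
    unfolding isomorphic_def using iso_arr_comp[OF D e1(1) e2(1)] cat_comp[OF D] e1 e2 by metis
qed

definition full_subcat :: "('o, 'm) cat \<Rightarrow> ('o, 'm) cat \<Rightarrow> bool" where
  "full_subcat C D \<longleftrightarrow> c_obj C \<subseteq> c_obj D \<and>
     c_arr C = {f \<in> c_arr D. c_dom D f \<in> c_obj C \<and> c_cod D f \<in> c_obj C} \<and>
     c_dom C = c_dom D \<and> c_cod C = c_cod D \<and>
     (\<forall>f\<in>c_arr C. \<forall>g\<in>c_arr C. c_cod D f = c_dom D g \<longrightarrow> c_comp C g f = c_comp D g f) \<and>
     (\<forall>x\<in>c_obj C. c_id C x = c_id D x)"

lemma full_subcatD:
  assumes "full_subcat C D"
  shows "c_obj C \<subseteq> c_obj D"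
    "f \<in> c_arr C \<longleftrightarrow> f \<in> c_arr D \<and> c_dom D f \<in> c_obj C \<and> c_cod D f \<in> c_obj C"
    "c_dom C = c_dom D" "c_cod C = c_cod D"
    "f \<in> c_arr C \<Longrightarrow> g \<in> c_arr C \<Longrightarrow> c_cod D f = c_dom D g \<Longrightarrow> c_comp C g f = c_comp D g f"
    "x \<in> c_obj C \<Longrightarrow> c_id C x = c_id D x"
  using assms unfolding full_subcat_def by blast+

lemma full_subcat_category:
  assumes D: "category D" and sub: "full_subcat C D"
  shows "category C"
proof -
  note S = full_subcatD[OF sub]
  have id_arr: "c_id D x \<in> c_arr C" if "x \<in> c_obj C" for x
    using that S(1,2) cat_id[OF D, of x] by auto
  show ?thesis
    unfolding category_def S(3,4)
  proof (intro conjI ballI impI)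
    fix f assume f: "f \<in> c_arr C"
    then show "c_dom D f \<in> c_obj C" "c_cod D f \<in> c_obj C" using S(2) by auto
    have fD: "f \<in> c_arr D" and ends: "c_dom D f \<in> c_obj C" "c_cod D f \<in> c_obj C"
      using f S(2) by auto
    show "c_comp C (c_id C (c_cod D f)) f = f"
      using S(5)[OF f id_arr[OF ends(2)]] S(6)[OF ends(2)] cat_id[OF D] cat_idl[OF D fD] ends S(1)
      by auto
    show "c_comp C f (c_id C (c_dom D f)) = f"
      using S(5)[OF id_arr[OF ends(1)] f] S(6)[OF ends(1)] cat_id[OF D] cat_idr[OF D fD] ends S(1)
      by auto
  next
    fix x assume x: "x \<in> c_obj C"
    then show "c_id C x \<in> c_arr C" "c_dom D (c_id C x) = x" "c_cod D (c_id C x) = x"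
      using id_arr S(1,6) cat_id[OF D] by auto
  next
    fix f g assume f: "f \<in> c_arr C" and g: "g \<in> c_arr C" and fg: "c_cod D f = c_dom D g"
    then show "c_comp C g f \<in> c_arr C" "c_dom D (c_comp C g f) = c_dom D f"
      "c_cod D (c_comp C g f) = c_cod D g"
      using S(2,5) cat_comp[OF D, of f g] by auto
  next
    fix f g h assume f: "f \<in> c_arr C" and g: "g \<in> c_arr C" and h: "h \<in> c_arr C"
      and fg: "c_cod D f = c_dom D g" and gh: "c_cod D g = c_dom D h"
    then show "c_comp C h (c_comp C g f) = c_comp C (c_comp C h g) f"
      using S(2,5) cat_comp[OF D] cat_assoc[OF D, of f g h] by auto
  qed
qed

locale full_subcat_chosen_isos =
  fixes C D :: "('o, 'm) cat" and Fm :: "'m \<Rightarrow> 'm" and G :: "'o \<Rightarrow> 'o" and e e' :: "'o \<Rightarrow> 'm"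
  assumes D: "category D" and sub: "full_subcat C D"
    and Fm: "\<And>f. f \<in> c_arr C \<Longrightarrow> Fm f = f"
    and G: "\<And>d. d \<in> c_obj D \<Longrightarrow> G d \<in> c_obj C"
    and e: "\<And>d. d \<in> c_obj D \<Longrightarrow> e d \<in> c_arr D \<and> c_dom D (e d) = G d \<and> c_cod D (e d) = d"
    and e': "\<And>d. d \<in> c_obj D \<Longrightarrow> e' d \<in> c_arr D \<and> c_dom D (e' d) = d \<and> c_cod D (e' d) = G d \<and>
       c_comp D (e' d) (e d) = c_id D (G d) \<and> c_comp D (e d) (e' d) = c_id D d"
begin

definition Gm :: "'m \<Rightarrow> 'm" where
  "Gm f = c_comp D (e' (c_cod D f)) (c_comp D f (e (c_dom D f)))"

lemma C_category: "category C"
  by (rule full_subcat_category[OF D sub])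

lemma e_iso: "d \<in> c_obj D \<Longrightarrow> iso_arr D (e d)"
  unfolding iso_arr_def using e[of d] e'[of d] by (intro conjI bexI[of _ "e' d"]) auto

lemma arr_C_iff: "f \<in> c_arr C \<longleftrightarrow> f \<in> c_arr D \<and> c_dom D f \<in> c_obj C \<and> c_cod D f \<in> c_obj C"
  by (rule full_subcatD(2)[OF sub])

lemma comp_e:
  assumes f: "f \<in> c_arr D"
  shows "c_comp D f (e (c_dom D f)) \<in> c_arr D" "c_dom D (c_comp D f (e (c_dom D f))) = G (c_dom D f)"
    "c_cod D (c_comp D f (e (c_dom D f))) = c_cod D f"
  using cat_comp[OF D _ f] e cat_dom_cod[OF D f] by auto

lemma Gm_arr:
  assumes f: "f \<in> c_arr D"
  shows "Gm f \<in> c_arr C" "c_dom D (Gm f) = G (c_dom D f)" "c_cod D (Gm f) = G (c_cod D f)"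
proof -
  have "Gm f \<in> c_arr D" "c_dom D (Gm f) = G (c_dom D f)" "c_cod D (Gm f) = G (c_cod D f)"
    unfolding Gm_def using comp_e[OF f] cat_comp[OF D _ conjunct1[OF e']] e' cat_dom_cod[OF D f]
    by auto
  then show "Gm f \<in> c_arr C" "c_dom D (Gm f) = G (c_dom D f)" "c_cod D (Gm f) = G (c_cod D f)"
    using arr_C_iff G cat_dom_cod[OF D f] by auto
qed

lemma Gm_id: "d \<in> c_obj D \<Longrightarrow> Gm (c_id D d) = c_id D (G d)"
  unfolding Gm_def using cat_id[OF D] cat_idl[OF D conjunct1[OF e]] e e' by simp

lemma Gm_comp:
  assumes f: "f \<in> c_arr D" and g: "g \<in> c_arr D" and fg: "c_cod D f = c_dom D g"
  shows "Gm (c_comp D g f) = c_comp D (Gm g) (Gm f)"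
proof -
  define x y z where "x = c_dom D f" "y = c_cod D f" "z = c_cod D g"
  have xyz: "x \<in> c_obj D" "y \<in> c_obj D" "z \<in> c_obj D" "c_dom D g = y"
    using cat_dom_cod[OF D f] cat_dom_cod[OF D g] fg x_y_z_def by auto
  note ex = e[OF xyz(1)] and ey = e[OF xyz(2)] and e'y = e'[OF xyz(2)] and e'z = e'[OF xyz(3)]
  have fe: "c_comp D f (e x) \<in> c_arr D" "c_dom D (c_comp D f (e x)) = G x"
    "c_cod D (c_comp D f (e x)) = y"
    using comp_e[OF f] x_y_z_def by auto
  have ge: "c_comp D g (e y) \<in> c_arr D" "c_dom D (c_comp D g (e y)) = G y"
    "c_cod D (c_comp D g (e y)) = z"
    using comp_e[OF g] x_y_z_def xyz by auto
  have e'fe: "c_comp D (e' y) (c_comp D f (e x)) \<in> c_arr D"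
    "c_cod D (c_comp D (e' y) (c_comp D f (e x))) = G y"
    using cat_comp[OF D fe(1) conjunct1[OF e'y]] fe e'y by auto
  have "c_comp D (Gm g) (Gm f)
      = c_comp D (e' z) (c_comp D (c_comp D g (e y)) (c_comp D (e' y) (c_comp D f (e x))))"
    unfolding Gm_def using cat_assoc[OF D e'fe(1) ge(1) conjunct1[OF e'z]] e'fe ge e'z x_y_z_def xyz
    by auto
  also have "c_comp D (c_comp D g (e y)) (c_comp D (e' y) (c_comp D f (e x)))
      = c_comp D (c_comp D (c_comp D g (e y)) (e' y)) (c_comp D f (e x))"
    using cat_assoc[OF D fe(1) conjunct1[OF e'y] ge(1)] fe e'y ge by auto
  also have "c_comp D (c_comp D g (e y)) (e' y) = c_comp D g (c_comp D (e y) (e' y))"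
    using cat_assoc[OF D conjunct1[OF e'y] conjunct1[OF ey] g] e'y ey xyz by auto
  also have "\<dots> = g" using e'y cat_idr[OF D g] xyz by auto
  also have "c_comp D g (c_comp D f (e x)) = c_comp D (c_comp D g f) (e x)"
    using cat_assoc[OF D conjunct1[OF ex] f g] ex fg x_y_z_def by auto
  finally show ?thesis
    unfolding Gm_def x_y_z_def using cat_comp[OF D f g fg] by simp
qed

lemma functor_Gm: "functor D C G Gm"
  unfolding functor_def
proof (intro conjI ballI impI)
  fix f g assume "f \<in> c_arr D" "g \<in> c_arr D" "c_cod D f = c_dom D g"
  then show "Gm (c_comp D g f) = c_comp C (Gm g) (Gm f)"
    using Gm_comp Gm_arr full_subcatD(5)[OF sub] by auto
qed (use D C_category G Gm_arr Gm_id full_subcatD[OF sub] in auto)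

lemma functor_Fm: "functor C D (\<lambda>x. x) Fm"
  unfolding functor_def
  using C_category D Fm full_subcatD[OF sub] cat_id[OF C_category] cat_comp[OF C_category] by auto

lemma unit_nat_iso: "nat_iso C C (\<lambda>x. x) (\<lambda>f. f) (G \<circ> (\<lambda>x. x)) (Gm \<circ> Fm) e'"
  unfolding nat_iso_def
proof (intro conjI ballI)
  show "functor C C (\<lambda>x. x) (\<lambda>f. f)" by (rule functor_id[OF C_category])
  show "functor C C (G \<circ> (\<lambda>x. x)) (Gm \<circ> Fm)" by (rule functor_comp[OF functor_Fm functor_Gm])
  fix x assume x: "x \<in> c_obj C"
  then have xD: "x \<in> c_obj D" using full_subcatD(1)[OF sub] by auto
  have "e' x \<in> c_arr C" "e x \<in> c_arr C" using e'[OF xD] e[OF xD] arr_C_iff G[OF xD] x by auto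
  then show "iso_arr C (e' x)"
    unfolding iso_arr_def using e'[OF xD] e[OF xD] G[OF xD] x full_subcatD(3-6)[OF sub] by auto
  show "c_dom C (e' x) = x" "c_cod C (e' x) = (G \<circ> (\<lambda>x. x)) x"
    using e'[OF xD] full_subcatD[OF sub] by auto
next
  fix f assume f: "f \<in> c_arr C"
  then have fD: "f \<in> c_arr D" and ends: "c_dom D f \<in> c_obj C" "c_cod D f \<in> c_obj C"
    using arr_C_iff by auto
  define x y where "x = c_dom D f" "y = c_cod D f"
  have xyD: "x \<in> c_obj D" "y \<in> c_obj D" using ends full_subcatD(1)[OF sub] x_y_def by auto
  have e'C: "e' x \<in> c_arr C" "e' y \<in> c_arr C" using e' xyD arr_C_iff G ends x_y_def by auto
  have "c_comp D (Gm f) (e' x) = c_comp D (e' y) (c_comp D (c_comp D f (e x)) (e' x))"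
    unfolding Gm_def x_y_def
    using cat_assoc[OF D conjunct1[OF e'[OF xyD(1)]] comp_e(1)[OF fD] conjunct1[OF e'[OF xyD(2)]]]
      comp_e[OF fD] e' xyD x_y_def by auto
  also have "c_comp D (c_comp D f (e x)) (e' x) = c_comp D f (c_comp D (e x) (e' x))"
    using cat_assoc[OF D conjunct1[OF e'[OF xyD(1)]] conjunct1[OF e[OF xyD(1)]] fD] e' e xyD x_y_def
    by auto
  also have "\<dots> = f" using e' xyD cat_idr[OF D fD] x_y_def by auto
  finally show "c_comp C ((Gm \<circ> Fm) f) (e' (c_dom C f)) = c_comp C (e' (c_cod C f)) ((\<lambda>f. f) f)"
    using Fm f Gm_arr[OF fD] e'C e' xyD full_subcatD[OF sub] x_y_def by auto
qed

lemma counit_nat_iso: "nat_iso D D ((\<lambda>x. x) \<circ> G) (Fm \<circ> Gm) (\<lambda>x. x) (\<lambda>f. f) e"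
  unfolding nat_iso_def
proof (intro conjI ballI)
  show "functor D D ((\<lambda>x. x) \<circ> G) (Fm \<circ> Gm)" by (rule functor_comp[OF functor_Gm functor_Fm])
  show "functor D D (\<lambda>x. x) (\<lambda>f. f)" by (rule functor_id[OF D])
  fix x assume "x \<in> c_obj D"
  then show "iso_arr D (e x)" "c_dom D (e x) = ((\<lambda>x. x) \<circ> G) x" "c_cod D (e x) = x"
    using e_iso e by auto
next
  fix f assume f: "f \<in> c_arr D"
  define x y where "x = c_dom D f" "y = c_cod D f"
  have xyD: "x \<in> c_obj D" "y \<in> c_obj D" using cat_dom_cod[OF D f] x_y_def by auto
  have "c_comp D (e y) (Gm f) = c_comp D (c_comp D (e y) (e' y)) (c_comp D f (e x))"
    unfolding Gm_def x_y_def
    using cat_assoc[OF D comp_e(1)[OF f] conjunct1[OF e'[OF xyD(2)]] conjunct1[OF e[OF xyD(2)]]]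
      comp_e[OF f] e' e xyD x_y_def by auto
  also have "\<dots> = c_comp D f (e x)"
    using e' xyD cat_idl[OF D comp_e(1)[OF f]] comp_e[OF f] x_y_def by auto
  finally show "c_comp D ((\<lambda>f. f) f) (e (c_dom D f)) = c_comp D (e (c_cod D f)) ((Fm \<circ> Gm) f)"
    using Fm Gm_arr[OF f] x_y_def by simp
qed

lemma equivalence: "equivalence C D (\<lambda>x. x) Fm"
  unfolding equivalence_def using functor_Fm functor_Gm unit_nat_iso counit_nat_iso by blast

end

lemma full_subcat_equivalence:
  assumes D: "category D" and sub: "full_subcat C D"
    and Fm: "\<And>f. f \<in> c_arr C \<Longrightarrow> Fm f = f"
    and ess_surj: "\<And>d. d \<in> c_obj D \<Longrightarrow> \<exists>c\<in>c_obj C. isomorphic D c d"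
  shows "equivalence C D (\<lambda>x. x) Fm"
proof -
  have "\<forall>d\<in>c_obj D. \<exists>c e e'. c \<in> c_obj C \<and> e \<in> c_arr D \<and> c_dom D e = c \<and> c_cod D e = d \<and>
      e' \<in> c_arr D \<and> c_dom D e' = d \<and> c_cod D e' = c \<and>
      c_comp D e' e = c_id D c \<and> c_comp D e e' = c_id D d"
    using ess_surj unfolding isomorphic_def by (fastforce elim!: iso_arrE)
  then obtain G e e' where "\<forall>d\<in>c_obj D. G d \<in> c_obj C \<and> e d \<in> c_arr D \<and> c_dom D (e d) = G d \<and>
      c_cod D (e d) = d \<and> e' d \<in> c_arr D \<and> c_dom D (e' d) = d \<and> c_cod D (e' d) = G d \<and>
      c_comp D (e' d) (e d) = c_id D (G d) \<and> c_comp D (e d) (e' d) = c_id D d"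
    by metis
  then interpret full_subcat_chosen_isos C D Fm G e e'
    by unfold_locales (use D sub Fm in auto)
  show ?thesis by (rule equivalence)
qed

section \<open>Quotients by a congruence on hom-sets\<close>

locale hom_congruence =
  fixes I :: "('o, 'm) cat" and le :: "'m \<Rightarrow> 'm \<Rightarrow> bool"
  assumes cat: "category I"
    and le_parallel: "\<And>f g. f \<in> c_arr I \<Longrightarrow> g \<in> c_arr I \<Longrightarrow> le f g \<Longrightarrow>
        c_dom I f = c_dom I g \<and> c_cod I f = c_cod I g"
    and le_comp_left: "\<And>f f' g. f \<in> c_arr I \<Longrightarrow> f' \<in> c_arr I \<Longrightarrow> g \<in> c_arr I \<Longrightarrow> le f f' \<Longrightarrow>
        c_cod I f = c_dom I g \<Longrightarrow> le (c_comp I g f) (c_comp I g f')"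
    and le_comp_right: "\<And>f g g'. f \<in> c_arr I \<Longrightarrow> g \<in> c_arr I \<Longrightarrow> g' \<in> c_arr I \<Longrightarrow> le g g' \<Longrightarrow>
        c_cod I f = c_dom I g \<Longrightarrow> le (c_comp I g f) (c_comp I g' f)"
begin

abbreviation "le_step \<equiv> {(f, g). f \<in> c_arr I \<and> g \<in> c_arr I \<and> (le f g \<or> le g f)}"
abbreviation "R \<equiv> gen_equiv I le"
abbreviation "Q \<equiv> quot_cat I le"

lemma R_eq: "R = le_step\<^sup>*"
  unfolding gen_equiv_def by simp

lemma R_parallel:
  assumes "(f, g) \<in> R" "f \<in> c_arr I"
  shows "g \<in> c_arr I \<and> c_dom I g = c_dom I f \<and> c_cod I g = c_cod I f"
  using assms(1) unfolding R_eq
proof (induction rule: rtrancl_induct)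
  case (step y z)
  then show ?case using le_parallel[of y z] le_parallel[of z y] by auto
qed (use assms in simp)

lemma R_refl: "(f, f) \<in> R"
  unfolding R_eq by simp

lemma R_sym: "(f, g) \<in> R \<Longrightarrow> (g, f) \<in> R"
proof -
  have "sym (le_step\<^sup>*)" by (rule sym_rtrancl) (auto simp: sym_def)
  then show "(f, g) \<in> R \<Longrightarrow> (g, f) \<in> R" unfolding R_eq sym_def by blast
qed

lemma R_trans: "(f, g) \<in> R \<Longrightarrow> (g, h) \<in> R \<Longrightarrow> (f, h) \<in> R"
  unfolding R_eq by (rule rtrancl_trans)

lemma qcls_eq_iff: "qcls I le f = qcls I le g \<longleftrightarrow> (f, g) \<in> R"
  unfolding qcls_def using R_refl R_sym R_trans by blast

lemma some_qcls: "((SOME h. h \<in> qcls I le f), f) \<in> R"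
proof -
  have "(SOME h. h \<in> qcls I le f) \<in> qcls I le f"
    by (rule someI[of _ f]) (simp add: qcls_def R_refl)
  then show ?thesis unfolding qcls_def using R_sym by blast
qed

lemma some_qcls_arr: "f \<in> c_arr I \<Longrightarrow> (SOME h. h \<in> qcls I le f) \<in> c_arr I"
  using R_parallel[OF R_sym[OF some_qcls]] by blast

lemma R_comp_left:
  assumes "(f, f') \<in> R" "f \<in> c_arr I" "g \<in> c_arr I" "c_cod I f = c_dom I g"
  shows "(c_comp I g f, c_comp I g f') \<in> R"
  using assms(1) unfolding R_eq
proof (induction rule: rtrancl_induct)
  case (step y z)
  have y: "y \<in> c_arr I" "c_cod I y = c_dom I g"
    using R_parallel[of f y] step assms unfolding R_eq by auto
  have z: "z \<in> c_arr I" "c_cod I z = c_dom I g"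
    using step y le_parallel[of y z] le_parallel[of z y] by auto
  have "(c_comp I g y, c_comp I g z) \<in> le_step"
    using step y z le_comp_left[of y z g] le_comp_left[of z y g] cat_comp[OF cat] assms by auto
  then show ?case using step by (meson rtrancl.rtrancl_into_rtrancl)
qed simp

lemma R_comp_right:
  assumes "(g, g') \<in> R" "f \<in> c_arr I" "g \<in> c_arr I" "c_cod I f = c_dom I g"
  shows "(c_comp I g f, c_comp I g' f) \<in> R"
  using assms(1) unfolding R_eq
proof (induction rule: rtrancl_induct)
  case (step y z)
  have y: "y \<in> c_arr I" "c_cod I f = c_dom I y"
    using R_parallel[of g y] step assms unfolding R_eq by auto
  have z: "z \<in> c_arr I" "c_cod I f = c_dom I z"
    using step y le_parallel[of y z] le_parallel[of z y] by auto
  have "(c_comp I y f, c_comp I z f) \<in> le_step"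
    using step y z le_comp_right[of f y z] le_comp_right[of f z y] cat_comp[OF cat] assms by auto
  then show ?case using step by (meson rtrancl.rtrancl_into_rtrancl)
qed simp

lemma R_comp:
  assumes "(f, f') \<in> R" "(g, g') \<in> R" "f \<in> c_arr I" "g \<in> c_arr I" "c_cod I f = c_dom I g"
  shows "(c_comp I g f, c_comp I g' f') \<in> R"
proof -
  have "(c_comp I g f, c_comp I g f') \<in> R" by (rule R_comp_left[OF assms(1,3,4,5)])
  moreover have "f' \<in> c_arr I" "c_cod I f' = c_dom I g" using R_parallel[OF assms(1,3)] assms by auto
  then have "(c_comp I g f', c_comp I g' f') \<in> R" using R_comp_right[OF assms(2)] assms by auto
  ultimately show ?thesis by (rule R_trans)
qed

lemma quot_simps:
  "c_obj Q = c_obj I" "c_arr Q = qcls I le ` c_arr I"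
  "c_dom Q E = c_dom I (SOME f. f \<in> E)" "c_cod Q E = c_cod I (SOME f. f \<in> E)"
  "c_comp Q E F = qcls I le (c_comp I (SOME f. f \<in> E) (SOME f. f \<in> F))"
  "c_id Q x = qcls I le (c_id I x)"
  unfolding quot_cat_def by simp_all

lemma quot_dom: "f \<in> c_arr I \<Longrightarrow> c_dom Q (qcls I le f) = c_dom I f"
  using quot_simps(3) R_parallel[OF R_sym[OF some_qcls]] by metis

lemma quot_cod: "f \<in> c_arr I \<Longrightarrow> c_cod Q (qcls I le f) = c_cod I f"
  using quot_simps(4) R_parallel[OF R_sym[OF some_qcls]] by metis

lemma quot_comp:
  assumes "f \<in> c_arr I" "g \<in> c_arr I" "c_cod I f = c_dom I g"
  shows "c_comp Q (qcls I le g) (qcls I le f) = qcls I le (c_comp I g f)"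
proof -
  have "(c_comp I (SOME h. h \<in> qcls I le g) (SOME h. h \<in> qcls I le f), c_comp I g f) \<in> R"
    using R_comp[OF some_qcls some_qcls] R_parallel[OF R_sym[OF some_qcls[of f]] assms(1)]
      R_parallel[OF R_sym[OF some_qcls[of g]] assms(2)] assms(3) by auto
  then show ?thesis unfolding quot_simps qcls_eq_iff .
qed

lemma quot_arr_iff: "E \<in> c_arr Q \<longleftrightarrow> (\<exists>f\<in>c_arr I. E = qcls I le f)"
  unfolding quot_simps by blast

lemma category_quot: "category Q"
  unfolding category_def
proof (intro conjI ballI impI)
  fix E assume "E \<in> c_arr Q"
  then obtain f where f: "f \<in> c_arr I" "E = qcls I le f" using quot_arr_iff by blast
  show "c_dom Q E \<in> c_obj Q" "c_cod Q E \<in> c_obj Q"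
    using f quot_dom quot_cod cat_dom_cod[OF cat f(1)] quot_simps(1) by auto
  show "c_comp Q (c_id Q (c_cod Q E)) E = E"
    using f quot_cod quot_simps(6) quot_comp cat_id[OF cat] cat_dom_cod[OF cat] cat_idl[OF cat] by auto
  show "c_comp Q E (c_id Q (c_dom Q E)) = E"
    using f quot_dom quot_simps(6) quot_comp cat_id[OF cat] cat_dom_cod[OF cat] cat_idr[OF cat] by auto
next
  fix x assume "x \<in> c_obj Q"
  then show "c_id Q x \<in> c_arr Q" "c_dom Q (c_id Q x) = x" "c_cod Q (c_id Q x) = x"
    using cat_id[OF cat] quot_simps quot_dom quot_cod by auto
next
  fix E F assume "E \<in> c_arr Q" "F \<in> c_arr Q" and EF: "c_cod Q E = c_dom Q F"
  then obtain f g where f: "f \<in> c_arr I" "E = qcls I le f" and g: "g \<in> c_arr I" "F = qcls I le g"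
    using quot_arr_iff by metis
  have fg: "c_cod I f = c_dom I g" using EF f g quot_dom quot_cod by simp
  show "c_comp Q F E \<in> c_arr Q" "c_dom Q (c_comp Q F E) = c_dom Q E"
    "c_cod Q (c_comp Q F E) = c_cod Q F"
    using quot_comp[OF f(1) g(1) fg] cat_comp[OF cat f(1) g(1) fg] f g quot_dom quot_cod quot_simps(2)
    by auto
next
  fix E F G assume "E \<in> c_arr Q" "F \<in> c_arr Q" "G \<in> c_arr Q"
    and EF: "c_cod Q E = c_dom Q F" and FG: "c_cod Q F = c_dom Q G"
  then obtain f g h where f: "f \<in> c_arr I" "E = qcls I le f" and g: "g \<in> c_arr I" "F = qcls I le g"
    and h: "h \<in> c_arr I" "G = qcls I le h"
    using quot_arr_iff by metis
  have fg: "c_cod I f = c_dom I g" using EF f g quot_dom quot_cod by simp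
  have gh: "c_cod I g = c_dom I h" using FG g h quot_dom quot_cod by simp
  show "c_comp Q G (c_comp Q F E) = c_comp Q (c_comp Q G F) E"
    using quot_comp[OF f(1) g(1) fg] quot_comp[OF g(1) h(1) gh] cat_comp[OF cat f(1) g(1) fg]
      cat_comp[OF cat g(1) h(1) gh] quot_comp cat_assoc[OF cat f(1) g(1) h(1) fg gh] f g h fg gh
    by simp
qed

lemma iso_arr_quot:
  assumes r: "r \<in> c_arr I" and s: "s \<in> c_arr I"
    and rs: "c_cod I r = c_dom I s" "c_cod I s = c_dom I r"
    and sr_id: "(c_comp I s r, c_id I (c_dom I r)) \<in> R"
    and rs_id: "(c_comp I r s, c_id I (c_dom I s)) \<in> R"
  shows "iso_arr Q (qcls I le r)"
  unfolding iso_arr_def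
proof (intro conjI bexI)
  show "qcls I le r \<in> c_arr Q" "qcls I le s \<in> c_arr Q" using r s quot_simps by auto
  show "c_dom Q (qcls I le s) = c_cod Q (qcls I le r)" "c_cod Q (qcls I le s) = c_dom Q (qcls I le r)"
    using quot_dom quot_cod r s rs by auto
  show "c_comp Q (qcls I le s) (qcls I le r) = c_id Q (c_dom Q (qcls I le r))"
    using quot_comp[OF r s rs(1)] sr_id quot_dom[OF r] quot_simps(6) qcls_eq_iff by simp
  show "c_comp Q (qcls I le r) (qcls I le s) = c_id Q (c_cod Q (qcls I le r))"
    using quot_comp[OF s r rs(2)] rs_id quot_cod[OF r] quot_simps(6) qcls_eq_iff rs by simp
qed

lemma hom_congruence_full_subcat:
  assumes sub: "full_subcat J I"
  shows "hom_congruence J le"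
proof
  note S = full_subcatD[OF sub]
  show "category J" by (rule full_subcat_category[OF cat sub])
  show "\<And>f g. f \<in> c_arr J \<Longrightarrow> g \<in> c_arr J \<Longrightarrow> le f g \<Longrightarrow>
      c_dom J f = c_dom J g \<and> c_cod J f = c_cod J g"
    using S(2-4) le_parallel by auto
  show "\<And>f f' g. f \<in> c_arr J \<Longrightarrow> f' \<in> c_arr J \<Longrightarrow> g \<in> c_arr J \<Longrightarrow> le f f' \<Longrightarrow>
      c_cod J f = c_dom J g \<Longrightarrow> le (c_comp J g f) (c_comp J g f')"
    using S(2-5) le_comp_left le_parallel by metis
  show "\<And>f g g'. f \<in> c_arr J \<Longrightarrow> g \<in> c_arr J \<Longrightarrow> g' \<in> c_arr J \<Longrightarrow> le g g' \<Longrightarrow>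
      c_cod J f = c_dom J g \<Longrightarrow> le (c_comp J g f) (c_comp J g' f)"
    using S(2-5) le_comp_right le_parallel by metis
qed

lemma qcls_full_subcat:
  assumes sub: "full_subcat J I" and f: "f \<in> c_arr J"
  shows "qcls J le f = qcls I le f"
proof -
  note S = full_subcatD[OF sub]
  have "gen_equiv J le \<subseteq> R"
    unfolding gen_equiv_def by (rule rtrancl_mono) (use S(2) in auto)
  moreover have "(f, g) \<in> gen_equiv J le" if "(f, g) \<in> R" for g
    using that unfolding R_eq
  proof (induction rule: rtrancl_induct)
    case (step y z)
    have "y \<in> c_arr I" "c_dom I y = c_dom I f" "c_cod I y = c_cod I f"
      using R_parallel[OF step(1)[folded R_eq]] f S(2) by auto
    moreover have "c_dom I z = c_dom I y" "c_cod I z = c_cod I y"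
      using step(2) le_parallel by fastforce+
    ultimately have "y \<in> c_arr J" "z \<in> c_arr J" using step(2) f S(2) by auto
    then show ?case
      using step(2,3) unfolding gen_equiv_def by (auto intro: rtrancl_into_rtrancl)
  qed (simp add: gen_equiv_def)
  ultimately show ?thesis unfolding qcls_def by blast
qed

lemma full_subcat_quot:
  assumes sub: "full_subcat J I"
  shows "full_subcat (quot_cat J le) Q"
proof -
  interpret J: hom_congruence J le by (rule hom_congruence_full_subcat[OF sub])
  note S = full_subcatD[OF sub]
  have arrs: "c_arr J.Q = {E \<in> c_arr Q. c_dom Q E \<in> c_obj J.Q \<and> c_cod Q E \<in> c_obj J.Q}"
  proof (intro equalityI subsetI)
    fix E assume "E \<in> c_arr J.Q"
    then obtain f where "f \<in> c_arr J" "E = qcls J le f" using J.quot_arr_iff by blast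
    then show "E \<in> {E \<in> c_arr Q. c_dom Q E \<in> c_obj J.Q \<and> c_cod Q E \<in> c_obj J.Q}"
      using qcls_full_subcat[OF sub] quot_dom quot_cod quot_simps(2) J.quot_simps(1) S(2) by auto
  next
    fix E assume E: "E \<in> {E \<in> c_arr Q. c_dom Q E \<in> c_obj J.Q \<and> c_cod Q E \<in> c_obj J.Q}"
    then obtain f where f: "f \<in> c_arr I" "E = qcls I le f" using quot_arr_iff by blast
    then have "f \<in> c_arr J" using E quot_dom quot_cod J.quot_simps(1) S(2) by auto
    then show "E \<in> c_arr J.Q" using qcls_full_subcat[OF sub] f J.quot_simps(2) by auto
  qed
  have comps: "c_comp J.Q F E = c_comp Q F E"
    if E: "E \<in> c_arr J.Q" and F: "F \<in> c_arr J.Q" and EF: "c_cod Q E = c_dom Q F" for E F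
  proof -
    obtain f g where f: "f \<in> c_arr J" "E = qcls J le f" and g: "g \<in> c_arr J" "F = qcls J le g"
      using E F J.quot_arr_iff by metis
    have fI: "f \<in> c_arr I" and gI: "g \<in> c_arr I" using f g S(2) by auto
    have fg: "c_cod I f = c_dom I g"
      using EF f g qcls_full_subcat[OF sub] quot_dom[OF fI] quot_cod[OF fI] quot_dom[OF gI] by simp
    have gf: "c_comp J g f = c_comp I g f" "c_comp I g f \<in> c_arr J"
      using S(5)[OF f(1) g(1)] cat_comp(1)[OF J.cat f(1) g(1)] fg S(3,4) by auto
    have "c_comp J.Q F E = qcls J le (c_comp J g f)"
      using J.quot_comp[OF f(1) g(1)] f g fg S(3,4) by simp
    also have "\<dots> = qcls I le (c_comp I g f)" using gf qcls_full_subcat[OF sub] by simp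
    also have "\<dots> = c_comp Q F E" using quot_comp[OF fI gI fg] f g qcls_full_subcat[OF sub] by simp
    finally show ?thesis .
  qed
  have ids: "c_id J.Q x = c_id Q x" if "x \<in> c_obj J.Q" for x
    using that cat_id(1)[OF J.cat] qcls_full_subcat[OF sub] S(6) J.quot_simps quot_simps by auto
  show ?thesis
    unfolding full_subcat_def
    using arrs comps ids S(1) J.quot_simps(1) quot_simps(1) S(3,4)
    by (auto simp: quot_cat_def)
qed

lemma qcls_some_full_subcat:
  assumes sub: "full_subcat J I" and E: "E \<in> c_arr (quot_cat J le)"
  shows "qcls I le (SOME f. f \<in> E) = E"
proof -
  interpret J: hom_congruence J le by (rule hom_congruence_full_subcat[OF sub])
  obtain f where f: "f \<in> c_arr J" "E = qcls J le f" using E J.quot_arr_iff by blast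
  have "qcls I le (SOME h. h \<in> E) = qcls J le (SOME h. h \<in> E)"
    using qcls_full_subcat[OF sub J.some_qcls_arr[OF f(1)]] f(2) by simp
  also have "\<dots> = E" using J.qcls_eq_iff J.some_qcls f(2) by blast
  finally show ?thesis .
qed

end

section \<open>The category \<open>\<integral> N^{-,+}(C)\<close>\<close>

lemma nerve_mor_split:
  obtains m Xo Xm n Yo Ym \<alpha> \<theta> where "f = ((m, Xo, Xm), (n, Yo, Ym), \<alpha>, \<theta>)"
  by (metis prod.exhaust)

lemma nerve_comp_simp:
  "nerve_comp C (B', D, \<beta>, \<phi>) (A, B, \<alpha>, \<theta>) =
     (A, D, (\<lambda>i. if i \<le> fst A then \<beta> (\<alpha> i) else undefined),
            (\<lambda>i. if i \<le> fst A then c_comp C (\<phi> (\<alpha> i)) (\<theta> i) else undefined))"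
  unfolding nerve_comp_def by simp

definition id_component_mor ::
    "('o, 'm) cat \<Rightarrow> ('o, 'm) nobj \<Rightarrow> ('o, 'm) nobj \<Rightarrow> (nat \<Rightarrow> nat) \<Rightarrow> ('o, 'm) nmor" where
  "id_component_mor C A B \<alpha> = (A, B, (\<lambda>i. if i \<le> fst A then \<alpha> i else undefined),
     (\<lambda>i. if i \<le> fst A then c_id C (fst (snd A) i) else undefined))"

lemma nerve_id_eq_id_component: "nerve_id C A = id_component_mor C A A (\<lambda>i. i)"
  by (cases A) (auto simp: nerve_id_def id_component_mor_def fun_eq_iff)

locale wide_subcat_pair =
  fixes C :: "('o, 'm) cat" and Cm Cp :: "'m set"
  assumes cat: "category C" and wide_Cm: "wide_subcat C Cm" and wide_Cp: "wide_subcat C Cp"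
begin

lemma Cm_arr: "f \<in> Cm \<Longrightarrow> f \<in> c_arr C"
  using wide_Cm unfolding wide_subcat_def by blast

lemma Cp_arr: "f \<in> Cp \<Longrightarrow> f \<in> c_arr C"
  using wide_Cp unfolding wide_subcat_def by blast

lemma Cp_id: "x \<in> c_obj C \<Longrightarrow> c_id C x \<in> Cp"
  using wide_Cp unfolding wide_subcat_def by blast

lemma Cp_comp: "f \<in> Cp \<Longrightarrow> g \<in> Cp \<Longrightarrow> c_cod C f = c_dom C g \<Longrightarrow> c_comp C g f \<in> Cp"
  using wide_Cp unfolding wide_subcat_def by blast

lemma nerve_objD:
  assumes "nerve_obj C Cm (n, Xo, Xm)"
  shows "\<And>i. i \<le> n \<Longrightarrow> Xo i \<in> c_obj C"
    "\<And>i. n < i \<Longrightarrow> Xo i = undefined"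
    "\<And>i j. i \<le> j \<Longrightarrow> j \<le> n \<Longrightarrow> Xm i j \<in> Cm"
    "\<And>i j. i \<le> j \<Longrightarrow> j \<le> n \<Longrightarrow> c_dom C (Xm i j) = Xo i"
    "\<And>i j. i \<le> j \<Longrightarrow> j \<le> n \<Longrightarrow> c_cod C (Xm i j) = Xo j"
    "\<And>i j. \<not> (i \<le> j \<and> j \<le> n) \<Longrightarrow> Xm i j = undefined"
    "\<And>i. i \<le> n \<Longrightarrow> Xm i i = c_id C (Xo i)"
    "\<And>i j k. i \<le> j \<Longrightarrow> j \<le> k \<Longrightarrow> k \<le> n \<Longrightarrow> c_comp C (Xm j k) (Xm i j) = Xm i k"
  using assms unfolding nerve_obj_def by auto

lemma nerve_morD:
  assumes "nerve_mor C Cm Cp ((m, Xo, Xm), (n, Yo, Ym), \<alpha>, \<theta>)"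
  shows "nerve_obj C Cm (m, Xo, Xm)" "nerve_obj C Cm (n, Yo, Ym)"
    "\<And>i. i \<le> m \<Longrightarrow> \<alpha> i \<le> n"
    "\<And>i j. i \<le> j \<Longrightarrow> j \<le> m \<Longrightarrow> \<alpha> i \<le> \<alpha> j"
    "\<And>i. m < i \<Longrightarrow> \<alpha> i = undefined"
    "\<And>i. m < i \<Longrightarrow> \<theta> i = undefined"
    "\<And>i. i \<le> m \<Longrightarrow> \<theta> i \<in> Cp"
    "\<And>i. i \<le> m \<Longrightarrow> c_dom C (\<theta> i) = Xo i"
    "\<And>i. i \<le> m \<Longrightarrow> c_cod C (\<theta> i) = Yo (\<alpha> i)"
    "\<And>i j. i \<le> j \<Longrightarrow> j \<le> m \<Longrightarrow> c_comp C (Ym (\<alpha> i) (\<alpha> j)) (\<theta> i) = c_comp C (\<theta> j) (Xm i j)"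
  using assms unfolding nerve_mor_def by auto

lemma nerve_morI:
  assumes "nerve_obj C Cm (m, Xo, Xm)" "nerve_obj C Cm (n, Yo, Ym)"
    "\<And>i. i \<le> m \<Longrightarrow> \<alpha> i \<le> n"
    "\<And>i j. i \<le> j \<Longrightarrow> j \<le> m \<Longrightarrow> \<alpha> i \<le> \<alpha> j"
    "\<And>i. m < i \<Longrightarrow> \<alpha> i = undefined"
    "\<And>i. m < i \<Longrightarrow> \<theta> i = undefined"
    "\<And>i. i \<le> m \<Longrightarrow> \<theta> i \<in> Cp"
    "\<And>i. i \<le> m \<Longrightarrow> c_dom C (\<theta> i) = Xo i"
    "\<And>i. i \<le> m \<Longrightarrow> c_cod C (\<theta> i) = Yo (\<alpha> i)"
    "\<And>i j. i \<le> j \<Longrightarrow> j \<le> m \<Longrightarrow> c_comp C (Ym (\<alpha> i) (\<alpha> j)) (\<theta> i) = c_comp C (\<theta> j) (Xm i j)"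
  shows "nerve_mor C Cm Cp ((m, Xo, Xm), (n, Yo, Ym), \<alpha>, \<theta>)"
  using assms unfolding nerve_mor_def by auto

lemma nerve_mor_ends: "nerve_mor C Cm Cp f \<Longrightarrow> nerve_obj C Cm (fst f) \<and> nerve_obj C Cm (fst (snd f))"
  by (cases f rule: nerve_mor_split) (use nerve_morD in simp)

lemma nerve_mor_comp:
  assumes f: "nerve_mor C Cm Cp ((m, Xo, Xm), (n, Yo, Ym), \<alpha>, \<theta>)"
    and g: "nerve_mor C Cm Cp ((n, Yo, Ym), (p, Zo, Zm), \<beta>, \<phi>)"
  shows "nerve_mor C Cm Cp ((m, Xo, Xm), (p, Zo, Zm), (\<lambda>i. if i \<le> m then \<beta> (\<alpha> i) else undefined),
            (\<lambda>i. if i \<le> m then c_comp C (\<phi> (\<alpha> i)) (\<theta> i) else undefined))"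
proof (rule nerve_morI)
  note F = nerve_morD[OF f] and G = nerve_morD[OF g]
  note X = nerve_objD[OF F(1)] and Y = nerve_objD[OF F(2)] and Z = nerve_objD[OF G(2)]
  fix i j assume ij: "i \<le> j" "j \<le> m"
  have a: "\<alpha> i \<le> \<alpha> j" "\<alpha> j \<le> n" using F ij by auto
  have b: "\<beta> (\<alpha> i) \<le> \<beta> (\<alpha> j)" "\<beta> (\<alpha> j) \<le> p" using G a by auto
  have th: "\<theta> i \<in> c_arr C" "\<theta> j \<in> c_arr C" using F(7) Cp_arr ij by auto
  have ph: "\<phi> (\<alpha> i) \<in> c_arr C" "\<phi> (\<alpha> j) \<in> c_arr C" using G(7) Cp_arr a by auto
  have xm: "Xm i j \<in> c_arr C" using X(3) Cm_arr ij by auto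
  have ym: "Ym (\<alpha> i) (\<alpha> j) \<in> c_arr C" using Y(3) Cm_arr a by auto
  have zm: "Zm (\<beta> (\<alpha> i)) (\<beta> (\<alpha> j)) \<in> c_arr C" using Z(3) Cm_arr b by auto
  have "c_comp C (Zm (\<beta> (\<alpha> i)) (\<beta> (\<alpha> j))) (c_comp C (\<phi> (\<alpha> i)) (\<theta> i))
      = c_comp C (c_comp C (Zm (\<beta> (\<alpha> i)) (\<beta> (\<alpha> j))) (\<phi> (\<alpha> i))) (\<theta> i)"
    using cat_assoc[OF cat th(1) ph(1) zm] F G Z a b ij by auto
  also have "c_comp C (Zm (\<beta> (\<alpha> i)) (\<beta> (\<alpha> j))) (\<phi> (\<alpha> i)) = c_comp C (\<phi> (\<alpha> j)) (Ym (\<alpha> i) (\<alpha> j))"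
    using G(10) a by auto
  also have "c_comp C (c_comp C (\<phi> (\<alpha> j)) (Ym (\<alpha> i) (\<alpha> j))) (\<theta> i)
      = c_comp C (\<phi> (\<alpha> j)) (c_comp C (Ym (\<alpha> i) (\<alpha> j)) (\<theta> i))"
    using cat_assoc[OF cat th(1) ym ph(2)] F G Y a ij by auto
  also have "c_comp C (Ym (\<alpha> i) (\<alpha> j)) (\<theta> i) = c_comp C (\<theta> j) (Xm i j)"
    using F(10) ij by auto
  also have "c_comp C (\<phi> (\<alpha> j)) (c_comp C (\<theta> j) (Xm i j)) = c_comp C (c_comp C (\<phi> (\<alpha> j)) (\<theta> j)) (Xm i j)"
    using cat_assoc[OF cat xm th(2) ph(2)] F G X a ij by auto
  finally show "c_comp C (Zm (if i \<le> m then \<beta> (\<alpha> i) else undefined) (if j \<le> m then \<beta> (\<alpha> j) else undefined))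
          (if i \<le> m then c_comp C (\<phi> (\<alpha> i)) (\<theta> i) else undefined) =
         c_comp C (if j \<le> m then c_comp C (\<phi> (\<alpha> j)) (\<theta> j) else undefined) (Xm i j)"
    using ij by simp
qed (use f g nerve_morD[OF f] nerve_morD[OF g] Cp_comp cat_comp[OF cat] Cp_arr in auto)

lemma nerve_mor_id_component:
  assumes A: "nerve_obj C Cm (m, Xo, Xm)" and B: "nerve_obj C Cm (n, Yo, Ym)"
    and range: "\<And>i. i \<le> m \<Longrightarrow> \<alpha> i \<le> n" and mono: "\<And>i j. i \<le> j \<Longrightarrow> j \<le> m \<Longrightarrow> \<alpha> i \<le> \<alpha> j"
    and objs: "\<And>i. i \<le> m \<Longrightarrow> Yo (\<alpha> i) = Xo i"
    and arrs: "\<And>i j. i \<le> j \<Longrightarrow> j \<le> m \<Longrightarrow> Ym (\<alpha> i) (\<alpha> j) = Xm i j"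
  shows "nerve_mor C Cm Cp (id_component_mor C (m, Xo, Xm) (n, Yo, Ym) \<alpha>)"
  unfolding id_component_mor_def fst_conv snd_conv
proof (rule nerve_morI)
  fix i j assume ij: "i \<le> j" "j \<le> m"
  have "Xm i j \<in> c_arr C" using nerve_objD(3)[OF A ij] Cm_arr by auto
  then show "c_comp C (Ym (if i \<le> m then \<alpha> i else undefined) (if j \<le> m then \<alpha> j else undefined))
      (if i \<le> m then c_id C (Xo i) else undefined) =
    c_comp C (if j \<le> m then c_id C (Xo j) else undefined) (Xm i j)"
    using ij arrs cat_idl[OF cat] cat_idr[OF cat] nerve_objD[OF A] by simp
qed (use A B range mono objs nerve_objD[OF A] Cp_id cat_id[OF cat] in auto)

lemma nerve_mor_id: "nerve_obj C Cm A \<Longrightarrow> nerve_mor C Cm Cp (nerve_id C A)"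
  unfolding nerve_id_eq_id_component by (cases A) (auto intro: nerve_mor_id_component)

lemma nerve_comp_id_component:
  assumes A: "nerve_obj C Cm (m, Xo, Xm)"
    and range: "\<And>i. i \<le> m \<Longrightarrow> \<alpha> i \<le> n" and objs: "\<And>i. i \<le> m \<Longrightarrow> Yo (\<alpha> i) = Xo i"
  shows "nerve_comp C (id_component_mor C (n, Yo, Ym) D \<beta>) (id_component_mor C (m, Xo, Xm) (n, Yo, Ym) \<alpha>)
    = id_component_mor C (m, Xo, Xm) D (\<beta> \<circ> \<alpha>)"
  unfolding id_component_mor_def nerve_comp_simp
  using range objs nerve_objD(1)[OF A] cat_id[OF cat] cat_idl[OF cat] by (auto simp: fun_eq_iff)

lemma nerve_le_id_component:
  assumes A: "nerve_obj C Cm (m, Xo, Xm)"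
    and below: "\<And>i. i \<le> m \<Longrightarrow> \<alpha> i \<le> \<alpha>' i \<and> Ym (\<alpha> i) (\<alpha>' i) = c_id C (Xo i)"
  shows "nerve_le C (id_component_mor C (m, Xo, Xm) (n, Yo, Ym) \<alpha>)
    (id_component_mor C (m, Xo, Xm) (n, Yo, Ym) \<alpha>')"
  unfolding id_component_mor_def nerve_le_def
  using below nerve_objD(1)[OF A] cat_id[OF cat] cat_idl[OF cat] by auto

abbreviation "N \<equiv> int_N C Cm Cp"

lemma int_N_simps: "c_obj N = {A. nerve_obj C Cm A}" "c_arr N = {f. nerve_mor C Cm Cp f}"
  "c_dom N = fst" "c_cod N = (\<lambda>f. fst (snd f))" "c_comp N = nerve_comp C" "c_id N = nerve_id C"
  unfolding int_N_def by (simp_all add: fun_eq_iff)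

lemma nerve_comp_assoc:
  assumes f: "nerve_mor C Cm Cp ((m, Xo, Xm), (n, Yo, Ym), \<alpha>, \<theta>)"
    and g: "nerve_mor C Cm Cp ((n, Yo, Ym), (p, Zo, Zm), \<beta>, \<phi>)"
    and h: "nerve_mor C Cm Cp ((p, Zo, Zm), (q, Wo, Wm), \<gamma>, \<psi>)"
  shows "nerve_comp C ((p, Zo, Zm), (q, Wo, Wm), \<gamma>, \<psi>)
      (nerve_comp C ((n, Yo, Ym), (p, Zo, Zm), \<beta>, \<phi>) ((m, Xo, Xm), (n, Yo, Ym), \<alpha>, \<theta>))
    = nerve_comp C (nerve_comp C ((p, Zo, Zm), (q, Wo, Wm), \<gamma>, \<psi>) ((n, Yo, Ym), (p, Zo, Zm), \<beta>, \<phi>))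
      ((m, Xo, Xm), (n, Yo, Ym), \<alpha>, \<theta>)"
proof -
  note F = nerve_morD[OF f] and G = nerve_morD[OF g] and H = nerve_morD[OF h]
  have "c_comp C (\<psi> (\<beta> (\<alpha> i))) (c_comp C (\<phi> (\<alpha> i)) (\<theta> i))
      = c_comp C (c_comp C (\<psi> (\<beta> (\<alpha> i))) (\<phi> (\<alpha> i))) (\<theta> i)" if i: "i \<le> m" for i
  proof -
    have a: "\<alpha> i \<le> n" "\<beta> (\<alpha> i) \<le> p" using F(3) G(3) i by auto
    show ?thesis
      using cat_assoc[OF cat Cp_arr[OF F(7)[OF i]] Cp_arr[OF G(7)[OF a(1)]] Cp_arr[OF H(7)[OF a(2)]]]
        F G H a i by simp
  qed
  then show ?thesis unfolding nerve_comp_simp using F(3) by (simp add: fun_eq_iff)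
qed

lemma nerve_comp_id:
  assumes f: "nerve_mor C Cm Cp ((m, Xo, Xm), (n, Yo, Ym), \<alpha>, \<theta>)"
  shows "nerve_comp C (nerve_id C (n, Yo, Ym)) ((m, Xo, Xm), (n, Yo, Ym), \<alpha>, \<theta>)
      = ((m, Xo, Xm), (n, Yo, Ym), \<alpha>, \<theta>)"
    "nerve_comp C ((m, Xo, Xm), (n, Yo, Ym), \<alpha>, \<theta>) (nerve_id C (m, Xo, Xm))
      = ((m, Xo, Xm), (n, Yo, Ym), \<alpha>, \<theta>)"
proof -
  note F = nerve_morD[OF f]
  have th: "\<And>i. i \<le> m \<Longrightarrow> \<theta> i \<in> c_arr C" using F(7) Cp_arr by auto
  show "nerve_comp C (nerve_id C (n, Yo, Ym)) ((m, Xo, Xm), (n, Yo, Ym), \<alpha>, \<theta>)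
      = ((m, Xo, Xm), (n, Yo, Ym), \<alpha>, \<theta>)"
    by (simp add: nerve_id_def nerve_comp_simp fun_eq_iff F cat_idl[OF cat] th)
  show "nerve_comp C ((m, Xo, Xm), (n, Yo, Ym), \<alpha>, \<theta>) (nerve_id C (m, Xo, Xm))
      = ((m, Xo, Xm), (n, Yo, Ym), \<alpha>, \<theta>)"
    by (simp add: nerve_id_def nerve_comp_simp fun_eq_iff F cat_idr[OF cat] th)
qed

lemma category_int_N: "category N"
  unfolding category_def int_N_simps
proof (intro conjI ballI impI)
  fix f assume "f \<in> {f. nerve_mor C Cm Cp f}"
  then have f: "nerve_mor C Cm Cp f" by simp
  then show "fst f \<in> {A. nerve_obj C Cm A}" "fst (snd f) \<in> {A. nerve_obj C Cm A}"
    using nerve_mor_ends by auto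
  show "nerve_comp C (nerve_id C (fst (snd f))) f = f" "nerve_comp C f (nerve_id C (fst f)) = f"
    using f nerve_comp_id by (cases f rule: nerve_mor_split; simp)+
next
  fix A assume "A \<in> {A. nerve_obj C Cm A}"
  then show "nerve_id C A \<in> {f. nerve_mor C Cm Cp f}"
    using nerve_mor_id[of A] by (simp only: mem_Collect_eq)
  show "fst (nerve_id C A) = A" "fst (snd (nerve_id C A)) = A"
    by (simp_all add: nerve_id_eq_id_component id_component_mor_def)
next
  fix f g assume "f \<in> {f. nerve_mor C Cm Cp f}" "g \<in> {f. nerve_mor C Cm Cp f}"
    and fg: "fst (snd f) = fst g"
  then have f: "nerve_mor C Cm Cp f" and g: "nerve_mor C Cm Cp g" by simp_all
  obtain m Xo Xm n Yo Ym \<alpha> \<theta> where fe: "f = ((m, Xo, Xm), (n, Yo, Ym), \<alpha>, \<theta>)" by (rule nerve_mor_split)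
  obtain n' Yo' Ym' p Zo Zm \<beta> \<phi> where "g = ((n', Yo', Ym'), (p, Zo, Zm), \<beta>, \<phi>)"
    by (rule nerve_mor_split)
  then have ge: "g = ((n, Yo, Ym), (p, Zo, Zm), \<beta>, \<phi>)" using fg fe by simp
  show "nerve_comp C g f \<in> {f. nerve_mor C Cm Cp f}"
    using nerve_mor_comp[OF f[unfolded fe] g[unfolded ge]] unfolding fe ge nerve_comp_simp by simp
  show "fst (nerve_comp C g f) = fst f" "fst (snd (nerve_comp C g f)) = fst (snd g)"
    unfolding fe ge nerve_comp_simp by simp_all
next
  fix f g h
  assume "f \<in> {f. nerve_mor C Cm Cp f}" "g \<in> {f. nerve_mor C Cm Cp f}" "h \<in> {f. nerve_mor C Cm Cp f}"
    and fg: "fst (snd f) = fst g" and gh: "fst (snd g) = fst h"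
  then have f: "nerve_mor C Cm Cp f" and g: "nerve_mor C Cm Cp g" and h: "nerve_mor C Cm Cp h"
    by simp_all
  obtain m Xo Xm n Yo Ym \<alpha> \<theta> where fe: "f = ((m, Xo, Xm), (n, Yo, Ym), \<alpha>, \<theta>)" by (rule nerve_mor_split)
  obtain n' Yo' Ym' p Zo Zm \<beta> \<phi> where "g = ((n', Yo', Ym'), (p, Zo, Zm), \<beta>, \<phi>)"
    by (rule nerve_mor_split)
  then have ge: "g = ((n, Yo, Ym), (p, Zo, Zm), \<beta>, \<phi>)" using fg fe by simp
  obtain p' Zo' Zm' q Wo Wm \<gamma> \<psi> where "h = ((p', Zo', Zm'), (q, Wo, Wm), \<gamma>, \<psi>)"
    by (rule nerve_mor_split)
  then have he: "h = ((p, Zo, Zm), (q, Wo, Wm), \<gamma>, \<psi>)" using gh ge by simp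
  show "nerve_comp C h (nerve_comp C g f) = nerve_comp C (nerve_comp C h g) f"
    using nerve_comp_assoc f g h unfolding fe ge he by blast
qed

lemma nerve_le_simp:
  "nerve_le C (A, B, \<alpha>, \<theta>) (A', B', \<alpha>', \<theta>') \<longleftrightarrow> A = A' \<and> B = B' \<and>
     (\<forall>i\<le>fst A. \<alpha> i \<le> \<alpha>' i \<and> \<theta>' i = c_comp C (snd (snd B) (\<alpha> i) (\<alpha>' i)) (\<theta> i))"
  unfolding nerve_le_def by simp

lemma nerve_le_parallel: "nerve_le C f g \<Longrightarrow> fst f = fst g \<and> fst (snd f) = fst (snd g)"
  by (cases f rule: prod_cases4; cases g rule: prod_cases4) (simp add: nerve_le_simp)

lemma nerve_le_comp_left:
  assumes f: "f \<in> c_arr N" and f': "f' \<in> c_arr N" and g: "g \<in> c_arr N" and le: "nerve_le C f f'"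
    and fg: "c_cod N f = c_dom N g"
  shows "nerve_le C (c_comp N g f) (c_comp N g f')"
proof -
  obtain m Xo Xm n Yo Ym \<alpha> \<theta> where fe: "f = ((m, Xo, Xm), (n, Yo, Ym), \<alpha>, \<theta>)"
    by (rule nerve_mor_split)
  obtain A B \<alpha>' \<theta>' where "f' = (A, B, \<alpha>', \<theta>')" by (rule prod_cases4)
  then have f'e: "f' = ((m, Xo, Xm), (n, Yo, Ym), \<alpha>', \<theta>')" using nerve_le_parallel[OF le] fe by simp
  obtain n' Yo' Ym' p Zo Zm \<beta> \<phi> where "g = ((n', Yo', Ym'), (p, Zo, Zm), \<beta>, \<phi>)"
    by (rule nerve_mor_split)
  then have ge: "g = ((n, Yo, Ym), (p, Zo, Zm), \<beta>, \<phi>)" using fg fe int_N_simps by simp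
  note F = nerve_morD[OF f[unfolded int_N_simps fe, simplified]]
    and F' = nerve_morD[OF f'[unfolded int_N_simps f'e, simplified]]
    and G = nerve_morD[OF g[unfolded int_N_simps ge, simplified]]
  note Y = nerve_objD[OF F(2)] and Z = nerve_objD[OF G(2)]
  have L: "\<forall>i\<le>m. \<alpha> i \<le> \<alpha>' i \<and> \<theta>' i = c_comp C (Ym (\<alpha> i) (\<alpha>' i)) (\<theta> i)"
    using le unfolding fe f'e nerve_le_simp by simp
  have "\<beta> (\<alpha> i) \<le> \<beta> (\<alpha>' i) \<and> c_comp C (\<phi> (\<alpha>' i)) (\<theta>' i)
      = c_comp C (Zm (\<beta> (\<alpha> i)) (\<beta> (\<alpha>' i))) (c_comp C (\<phi> (\<alpha> i)) (\<theta> i))"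
    if i: "i \<le> m" for i
  proof -
    have a: "\<alpha> i \<le> \<alpha>' i" "\<alpha>' i \<le> n" "\<alpha> i \<le> n" using L F'(3) F(3) i by auto
    have b: "\<beta> (\<alpha> i) \<le> \<beta> (\<alpha>' i)" "\<beta> (\<alpha>' i) \<le> p" using G(4) G(3) a by auto
    have th: "\<theta> i \<in> c_arr C" using F(7) Cp_arr i by auto
    have ph: "\<phi> (\<alpha> i) \<in> c_arr C" "\<phi> (\<alpha>' i) \<in> c_arr C" using G(7) Cp_arr a by auto
    have ym: "Ym (\<alpha> i) (\<alpha>' i) \<in> c_arr C" using Y(3) Cm_arr a by auto
    have zm: "Zm (\<beta> (\<alpha> i)) (\<beta> (\<alpha>' i)) \<in> c_arr C" using Z(3) Cm_arr b by auto
    have "c_comp C (\<phi> (\<alpha>' i)) (\<theta>' i) = c_comp C (\<phi> (\<alpha>' i)) (c_comp C (Ym (\<alpha> i) (\<alpha>' i)) (\<theta> i))"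
      using L i by simp
    also have "\<dots> = c_comp C (c_comp C (\<phi> (\<alpha>' i)) (Ym (\<alpha> i) (\<alpha>' i))) (\<theta> i)"
      using cat_assoc[OF cat th ym ph(2)] F G Y a i by auto
    also have "c_comp C (\<phi> (\<alpha>' i)) (Ym (\<alpha> i) (\<alpha>' i)) = c_comp C (Zm (\<beta> (\<alpha> i)) (\<beta> (\<alpha>' i))) (\<phi> (\<alpha> i))"
      using G(10) a by auto
    also have "c_comp C (c_comp C (Zm (\<beta> (\<alpha> i)) (\<beta> (\<alpha>' i))) (\<phi> (\<alpha> i))) (\<theta> i)
        = c_comp C (Zm (\<beta> (\<alpha> i)) (\<beta> (\<alpha>' i))) (c_comp C (\<phi> (\<alpha> i)) (\<theta> i))"
      using cat_assoc[OF cat th ph(1) zm] F G Z a b i by auto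
    finally show ?thesis using b by simp
  qed
  then show ?thesis unfolding fe f'e ge int_N_simps nerve_comp_simp nerve_le_simp by simp
qed

lemma nerve_le_comp_right:
  assumes f: "f \<in> c_arr N" and g: "g \<in> c_arr N" and g': "g' \<in> c_arr N" and le: "nerve_le C g g'"
    and fg: "c_cod N f = c_dom N g"
  shows "nerve_le C (c_comp N g f) (c_comp N g' f)"
proof -
  obtain l Wo Wm m Xo Xm \<gamma> \<psi> where fe: "f = ((l, Wo, Wm), (m, Xo, Xm), \<gamma>, \<psi>)"
    by (rule nerve_mor_split)
  obtain m' Xo' Xm' n Yo Ym \<alpha> \<theta> where "g = ((m', Xo', Xm'), (n, Yo, Ym), \<alpha>, \<theta>)"
    by (rule nerve_mor_split)
  then have ge: "g = ((m, Xo, Xm), (n, Yo, Ym), \<alpha>, \<theta>)" using fg fe int_N_simps by simp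
  obtain A B \<alpha>' \<theta>' where "g' = (A, B, \<alpha>', \<theta>')" by (rule prod_cases4)
  then have g'e: "g' = ((m, Xo, Xm), (n, Yo, Ym), \<alpha>', \<theta>')" using nerve_le_parallel[OF le] ge by simp
  note F = nerve_morD[OF f[unfolded int_N_simps fe, simplified]]
    and G' = nerve_morD[OF g'[unfolded int_N_simps g'e, simplified]]
    and G = nerve_morD[OF g[unfolded int_N_simps ge, simplified]]
  note Y = nerve_objD[OF G(2)]
  have L: "\<forall>i\<le>m. \<alpha> i \<le> \<alpha>' i \<and> \<theta>' i = c_comp C (Ym (\<alpha> i) (\<alpha>' i)) (\<theta> i)"
    using le unfolding ge g'e nerve_le_simp by simp
  have "\<alpha> (\<gamma> j) \<le> \<alpha>' (\<gamma> j) \<and> c_comp C (\<theta>' (\<gamma> j)) (\<psi> j)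
      = c_comp C (Ym (\<alpha> (\<gamma> j)) (\<alpha>' (\<gamma> j))) (c_comp C (\<theta> (\<gamma> j)) (\<psi> j))"
    if j: "j \<le> l" for j
  proof -
    have c: "\<gamma> j \<le> m" using F(3) j by auto
    have a: "\<alpha> (\<gamma> j) \<le> \<alpha>' (\<gamma> j)" "\<alpha>' (\<gamma> j) \<le> n" using L G'(3) c by auto
    have ps: "\<psi> j \<in> c_arr C" using F(7) Cp_arr j by auto
    have th: "\<theta> (\<gamma> j) \<in> c_arr C" using G(7) Cp_arr c by auto
    have ym: "Ym (\<alpha> (\<gamma> j)) (\<alpha>' (\<gamma> j)) \<in> c_arr C" using Y(3) Cm_arr a by auto
    have "c_comp C (\<theta>' (\<gamma> j)) (\<psi> j)
        = c_comp C (c_comp C (Ym (\<alpha> (\<gamma> j)) (\<alpha>' (\<gamma> j))) (\<theta> (\<gamma> j))) (\<psi> j)"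
      using L c by simp
    also have "\<dots> = c_comp C (Ym (\<alpha> (\<gamma> j)) (\<alpha>' (\<gamma> j))) (c_comp C (\<theta> (\<gamma> j)) (\<psi> j))"
      using cat_assoc[OF cat ps th ym] F G Y a c j by auto
    finally show ?thesis using a by simp
  qed
  then show ?thesis unfolding fe g'e ge int_N_simps nerve_comp_simp nerve_le_simp by simp
qed

lemma hom_congruence_int_N: "hom_congruence N (nerve_le C)"
proof
  show "category N" by (rule category_int_N)
  show "\<And>f g. nerve_le C f g \<Longrightarrow> c_dom N f = c_dom N g \<and> c_cod N f = c_cod N g"
    using nerve_le_parallel int_N_simps by simp
qed (auto intro: nerve_le_comp_left nerve_le_comp_right)

lemma full_subcat_int_N_plus: "full_subcat (int_N_plus C Cm Cp) N"
  using nerve_mor_ends unfolding full_subcat_def int_N_plus_def int_N_def by auto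

end

section \<open>Contracting an identity edge\<close>

definition coface :: "nat \<Rightarrow> nat \<Rightarrow> nat" where
  "coface j t = (if t < j then t else Suc t)"

definition codegeneracy :: "nat \<Rightarrow> nat \<Rightarrow> nat" where
  "codegeneracy j t = (if t \<le> j then t else t - 1)"

lemma codegeneracy_coface: "codegeneracy j (coface (Suc j) t) = t"
  unfolding coface_def codegeneracy_def by auto

lemma coface_codegeneracy: "coface (Suc j) (codegeneracy j t) = (if t = Suc j then j else t)"
  unfolding coface_def codegeneracy_def by auto

definition reindex :: "('o, 'm) nobj \<Rightarrow> nat \<Rightarrow> (nat \<Rightarrow> nat) \<Rightarrow> ('o, 'm) nobj" where
  "reindex A k d = (k, (\<lambda>t. if t \<le> k then fst (snd A) (d t) else undefined),
     (\<lambda>a b. if a \<le> b \<and> b \<le> k then snd (snd A) (d a) (d b) else undefined))"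

context wide_subcat_pair
begin

lemma nerve_obj_reindex:
  assumes A: "nerve_obj C Cm (n, Xo, Xm)"
    and range: "\<And>t. t \<le> k \<Longrightarrow> d t \<le> n" and mono: "\<And>a b. a \<le> b \<Longrightarrow> d a \<le> d b"
  shows "nerve_obj C Cm (reindex (n, Xo, Xm) k d)"
proof -
  note X = nerve_objD[OF A]
  have "c_comp C (Xm (d b) (d c)) (Xm (d a) (d b)) = Xm (d a) (d c)"
    if "a \<le> b" "b \<le> c" "c \<le> k" for a b c
    using X(8) that range mono by auto
  then show ?thesis
    unfolding reindex_def nerve_obj_def using X range mono by auto
qed

lemma nerve_mor_from_reindex:
  assumes A: "nerve_obj C Cm (n, Xo, Xm)"
    and range: "\<And>t. t \<le> k \<Longrightarrow> d t \<le> n" and mono: "\<And>a b. a \<le> b \<Longrightarrow> d a \<le> d b"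
  shows "nerve_mor C Cm Cp (id_component_mor C (reindex (n, Xo, Xm) k d) (n, Xo, Xm) d)"
  using nerve_mor_id_component[OF nerve_obj_reindex[OF A range mono, unfolded reindex_def] A]
    range mono
  by (simp add: reindex_def)

lemma nerve_mor_to_reindex:
  assumes A: "nerve_obj C Cm (n, Xo, Xm)"
    and range: "\<And>t. t \<le> k \<Longrightarrow> d t \<le> n" and mono: "\<And>a b. a \<le> b \<Longrightarrow> d a \<le> d b"
    and range': "\<And>t. t \<le> n \<Longrightarrow> \<sigma> t \<le> k" and mono': "\<And>a b. a \<le> b \<Longrightarrow> \<sigma> a \<le> \<sigma> b"
    and objs: "\<And>t. t \<le> n \<Longrightarrow> Xo (d (\<sigma> t)) = Xo t"
    and arrs: "\<And>a b. a \<le> b \<Longrightarrow> b \<le> n \<Longrightarrow> Xm (d (\<sigma> a)) (d (\<sigma> b)) = Xm a b"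
  shows "nerve_mor C Cm Cp (id_component_mor C (n, Xo, Xm) (reindex (n, Xo, Xm) k d) \<sigma>)"
  using nerve_mor_id_component[OF A nerve_obj_reindex[OF A range mono, unfolded reindex_def]]
    range' mono' objs arrs
  by (simp add: reindex_def)

text \<open>Deleting the vertex \<open>i + 1\<close> of a simplex whose edge \<open>i \<rightarrow> i + 1\<close> is an identity loses nothing:
  every edge of the simplex is an edge of the face.\<close>
lemma degenerate_edge_arr:
  assumes A: "nerve_obj C Cm (n, Xo, Xm)" and i: "i < n"
    and same: "Xo (Suc i) = Xo i" and ident: "Xm i (Suc i) = c_id C (Xo i)"
    and ab: "a \<le> b" "b \<le> n"
  shows "Xm (coface (Suc i) (codegeneracy i a)) (coface (Suc i) (codegeneracy i b)) = Xm a b"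
proof -
  note X = nerve_objD[OF A]
  consider "a \<noteq> Suc i" "b \<noteq> Suc i" | "a = Suc i" | "a \<noteq> Suc i" "b = Suc i" by blast
  then show ?thesis
  proof cases
    case 1
    then show ?thesis by (simp add: coface_codegeneracy)
  next
    case 2
    then have "Xm i b = c_comp C (Xm (Suc i) b) (Xm i (Suc i))" using X(8)[of i "Suc i" b] ab by simp
    also have "\<dots> = Xm (Suc i) b"
      unfolding ident using cat_idr[OF cat Cm_arr[OF X(3)[of "Suc i" b]]] X(4)[of "Suc i" b] ab 2 same
      by simp
    moreover have "Xm i i = Xm (Suc i) (Suc i)" using X(7)[of i] X(7)[of "Suc i"] same i by simp
    ultimately show ?thesis using 2 ab by (simp add: coface_codegeneracy)
  next
    case 3
    then have a: "a \<le> i" using ab by simp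
    have "Xm a (Suc i) = c_comp C (Xm i (Suc i)) (Xm a i)" using X(8)[of a i "Suc i"] a ab 3 by simp
    also have "\<dots> = Xm a i"
      unfolding ident using cat_idl[OF cat Cm_arr[OF X(3)[of a i]]] X(5)[of a i] a i by simp
    finally show ?thesis using 3 ab by (simp add: coface_codegeneracy)
  qed
qed

end

lemma coface_le: "t \<le> n - 1 \<Longrightarrow> j \<le> n \<Longrightarrow> 0 < n \<Longrightarrow> coface j t \<le> n"
  unfolding coface_def by auto

lemma coface_mono: "a \<le> b \<Longrightarrow> coface j a \<le> coface j b"
  unfolding coface_def by auto

lemma codegeneracy_le: "t \<le> n \<Longrightarrow> j < n \<Longrightarrow> codegeneracy j t \<le> n - 1"
  unfolding codegeneracy_def by auto

lemma codegeneracy_mono: "a \<le> b \<Longrightarrow> codegeneracy j a \<le> codegeneracy j b"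
  unfolding codegeneracy_def by auto

locale degenerate_edge = wide_subcat_pair +
  fixes n i :: nat and Xo Xm
  assumes X_obj: "nerve_obj C Cm (n, Xo, Xm)" and i: "i < n"
    and same: "Xo (Suc i) = Xo i" and ident: "Xm i (Suc i) = c_id C (Xo i)"
begin

abbreviation "X \<equiv> (n, Xo, Xm)"
abbreviation "face \<equiv> reindex X (n - 1) (coface (Suc i))"
abbreviation "face_inclusion \<equiv> id_component_mor C face X (coface (Suc i))"
abbreviation "face_collapse \<equiv> id_component_mor C X face (codegeneracy i)"

lemma coface_range: "t \<le> n - 1 \<Longrightarrow> coface (Suc i) t \<le> n"
  using coface_le i by simp

lemma codegeneracy_range: "t \<le> n \<Longrightarrow> codegeneracy i t \<le> n - 1"
  using codegeneracy_le i by simp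

lemma face_obj: "nerve_obj C Cm face"
  using nerve_obj_reindex[OF X_obj coface_range coface_mono] .

lemma face_inclusion_arr: "face_inclusion \<in> c_arr N"
  unfolding int_N_simps using nerve_mor_from_reindex[OF X_obj coface_range coface_mono] by simp

lemma face_collapse_arr: "face_collapse \<in> c_arr N"
proof -
  have "Xo (coface (Suc i) (codegeneracy i t)) = Xo t" for t
    using same by (simp add: coface_codegeneracy)
  then show ?thesis
    unfolding int_N_simps
    using nerve_mor_to_reindex[OF X_obj coface_range coface_mono codegeneracy_range codegeneracy_mono]
      degenerate_edge_arr[OF X_obj i same ident]
    by simp
qed

lemma collapse_after_inclusion: "c_comp N face_collapse face_inclusion = c_id N face"
proof -
  have "c_comp N face_collapse face_inclusion
      = id_component_mor C face face (codegeneracy i \<circ> coface (Suc i))"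
    unfolding int_N_simps reindex_def
    by (rule nerve_comp_id_component[OF face_obj[unfolded reindex_def]]) (auto simp: coface_range)
  also have "\<dots> = c_id N face"
    by (simp add: int_N_simps nerve_id_eq_id_component id_component_mor_def codegeneracy_coface
        fun_eq_iff)
  finally show ?thesis .
qed

lemma inclusion_after_collapse_le: "nerve_le C (c_comp N face_inclusion face_collapse) (c_id N X)"
proof -
  have "c_comp N face_inclusion face_collapse
      = id_component_mor C X X (coface (Suc i) \<circ> codegeneracy i)"
    unfolding int_N_simps reindex_def
    by (rule nerve_comp_id_component[OF X_obj])
      (use codegeneracy_range in \<open>auto simp: coface_codegeneracy same\<close>)
  moreover have "nerve_le C (id_component_mor C X X (coface (Suc i) \<circ> codegeneracy i))
      (id_component_mor C X X (\<lambda>t. t))"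
    using nerve_objD(7)[OF X_obj] ident same
    by (intro nerve_le_id_component[OF X_obj]) (auto simp: coface_codegeneracy)
  ultimately show ?thesis by (simp add: int_N_simps nerve_id_eq_id_component)
qed

lemma isomorphic_face: "isomorphic (quot_cat N (nerve_le C)) face X"
proof -
  interpret N: hom_congruence N "nerve_le C" by (rule hom_congruence_int_N)
  have ends: "c_dom N face_inclusion = face" "c_cod N face_inclusion = X"
    "c_dom N face_collapse = X" "c_cod N face_collapse = face"
    by (simp_all add: int_N_simps id_component_mor_def)
  have "c_comp N face_inclusion face_collapse \<in> c_arr N" "c_id N X \<in> c_arr N"
    using cat_comp(1)[OF category_int_N face_collapse_arr face_inclusion_arr] ends
      cat_id(1)[OF category_int_N] X_obj int_N_simps(1) by auto
  then have "(c_comp N face_inclusion face_collapse, c_id N X) \<in> N.R"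
    unfolding N.R_eq using inclusion_after_collapse_le by (intro r_into_rtrancl) auto
  then have "iso_arr (quot_cat N (nerve_le C)) (qcls N (nerve_le C) face_inclusion)"
    using N.iso_arr_quot[OF face_inclusion_arr face_collapse_arr] ends collapse_after_inclusion N.R_refl
    by simp
  then show ?thesis
    unfolding isomorphic_def using N.quot_dom[OF face_inclusion_arr] N.quot_cod[OF face_inclusion_arr] ends
    by auto
qed

end

section \<open>Reflecting identities up to isomorphism\<close>

locale wf_wide_subcat_pair = wide_subcat_pair +
  assumes wf: "wfP (reedy_rel C Cm Cp)"
begin

lemma Cm_endo_id:
  assumes "f \<in> Cm" "c_dom C f = y" "c_cod C f = y" "y \<in> c_obj C"
  shows "f = c_id C y"
  using wfp_imp_irreflp[OF wf] assms unfolding irreflp_def reedy_rel_def by blast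

lemma reedy_rel_Cm:
  assumes "f \<in> Cm" "c_dom C f = y" "c_cod C f = x" "x \<noteq> y" "x \<in> c_obj C" "y \<in> c_obj C"
  shows "reedy_rel C Cm Cp x y"
proof -
  have "f \<noteq> c_id C y" using assms cat_id[OF cat, of y] by auto
  then show ?thesis unfolding reedy_rel_def using assms by blast
qed

lemma nerve_obj_constant_between:
  assumes X: "nerve_obj C Cm (n, Xo, Xm)" and ijk: "i \<le> j" "j \<le> k" "k \<le> n" and eq: "Xo i = Xo k"
  shows "Xo j = Xo i"
proof (rule ccontr)
  assume ne: "Xo j \<noteq> Xo i"
  note X = nerve_objD[OF X]
  have "reedy_rel C Cm Cp (Xo j) (Xo i)"
    using reedy_rel_Cm[OF X(3)[of i j]] X ijk ne by auto
  moreover have "reedy_rel C Cm Cp (Xo i) (Xo j)"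
    using reedy_rel_Cm[OF X(3)[of j k]] X ijk ne eq by auto
  ultimately show False using wfp_imp_asymp[OF wf] by (meson asympD)
qed

lemma identity_edge_if_not_reflects_ids:
  assumes X: "nerve_obj C Cm (n, Xo, Xm)" and not_refl: "\<not> reflects_ids C (n, Xo, Xm)"
  obtains i where "i < n" "Xo (Suc i) = Xo i" "Xm i (Suc i) = c_id C (Xo i)"
proof -
  note X' = nerve_objD[OF X]
  from not_refl obtain i j y where ij: "i \<le> j" "j \<le> n" "i \<noteq> j" and y: "y \<in> c_obj C" "Xm i j = c_id C y"
    unfolding reflects_ids_def by auto
  have "Xo i = y" "Xo j = y" using X'(4)[of i j] X'(5)[of i j] ij y cat_id[OF cat] by auto
  then have same: "Xo (Suc i) = Xo i" using nerve_obj_constant_between[OF X, of i "Suc i" j] ij by auto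
  then have "Xm i (Suc i) = c_id C (Xo i)"
    using Cm_endo_id[OF X'(3)[of i "Suc i"]] X' ij by auto
  with same ij show ?thesis by (intro that[of i]) auto
qed

lemma isomorphic_reflects_ids:
  assumes "nerve_obj C Cm A"
  shows "\<exists>B. nerve_obj C Cm B \<and> reflects_ids C B \<and> isomorphic (quot_cat N (nerve_le C)) B A"
  using assms
proof (induction "fst A" arbitrary: A rule: less_induct)
  case less
  interpret N: hom_congruence N "nerve_le C" by (rule hom_congruence_int_N)
  obtain n Xo Xm where A: "A = (n, Xo, Xm)" by (rule prod_cases3)
  show ?case
  proof (cases "reflects_ids C A")
    case True
    with less.prems show ?thesis
      using isomorphic_refl[OF N.category_quot] N.quot_simps(1) int_N_simps(1) by (intro exI[of _ A]) auto
  next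
    case False
    then obtain i where i: "i < n" "Xo (Suc i) = Xo i" "Xm i (Suc i) = c_id C (Xo i)"
      using identity_edge_if_not_reflects_ids less.prems A by blast
    interpret degenerate_edge C Cm Cp n i Xo Xm
      by unfold_locales (use less.prems A i in auto)
    obtain B where "nerve_obj C Cm B" "reflects_ids C B" "isomorphic (quot_cat N (nerve_le C)) B face"
      using less.hyps[OF _ face_obj] i A by (auto simp: reindex_def)
    with A show ?thesis
      using isomorphic_trans[OF N.category_quot _ isomorphic_face] by (intro exI[of _ B]) auto
  qed
qed

end

lemma reedy_wf_wide_subcat_pair: "reedy C Cm Cp \<Longrightarrow> wf_wide_subcat_pair C Cm Cp"
  unfolding reedy_def wf_wide_subcat_pair_def wf_wide_subcat_pair_axioms_def wide_subcat_pair_def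
  by blast

theorem lemma6p2:
  fixes C :: "('o, 'm) cat" and Cm Cp :: "'m set"
  assumes "reedy C Cm Cp"
  shows "equivalence (Down C Cm Cp) (Down_star C Cm Cp) (\<lambda>A. A) (Down_incl_mor C Cm Cp)"
proof -
  interpret wf_wide_subcat_pair C Cm Cp by (rule reedy_wf_wide_subcat_pair[OF assms])
  interpret N: hom_congruence N "nerve_le C" by (rule hom_congruence_int_N)
  note sub = full_subcat_int_N_plus
  show ?thesis
    unfolding Down_def Down_star_def
  proof (rule full_subcat_equivalence)
    show "category (quot_cat N (nerve_le C))" by (rule N.category_quot)
    show "full_subcat (quot_cat (int_N_plus C Cm Cp) (nerve_le C)) (quot_cat N (nerve_le C))"
      by (rule N.full_subcat_quot[OF sub])
    show "Down_incl_mor C Cm Cp E = E" if "E \<in> c_arr (quot_cat (int_N_plus C Cm Cp) (nerve_le C))" for E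
      using N.qcls_some_full_subcat[OF sub that] unfolding Down_incl_mor_def .
    show "\<exists>c\<in>c_obj (quot_cat (int_N_plus C Cm Cp) (nerve_le C)). isomorphic (quot_cat N (nerve_le C)) c d"
      if "d \<in> c_obj (quot_cat N (nerve_le C))" for d
      using isomorphic_reflects_ids that by (auto simp: quot_cat_def int_N_def int_N_plus_def)
  qed
qed

end
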